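(* The proof system for partial correctness described in the context is sound and relatively complete: for every nondeterministic quantum program $S$ and all quantum assertions $\Theta,\Psi$, the formula $\{\Theta\}S\{\Psi\}$ is derivable in the proof system if and only if $\models_{\mathrm{par}}\{\Theta\}S\{\Psi\}$. Here "relative" means that the side conditions $\Theta\le_{\mathit{inf}}\Theta'$ and $\Psi'\le_{\mathit{inf}}\Psi$ of rule (Imp) are semantic conditions: every true instance may be used.
   Context: Setting. Let $\mathcal{V}$ be a finite set of qubit variables. For $V\subseteq\mathcal{V}$ put $\mathcal{H}_V=\bigotimes_{q\in V}\mathcal{H}_q$ with $\mathcal{H}_q\cong\mathbb{C}^2$. For a finite-dimensional Hilbert space $\mathcal{H}$: - $\mathcal{D}(\mathcal{H})$ is the set of partial density operators (positive operators of trace $\le1$), and $\sqsubseteq$ is the Löwner order. - A super-operator is a completely positive, trace-nonincreasing linear map on $\mathcal{L}(\mathcal{H})$. If $\mathcal{E}$ has Kraus operators $\{E_i\}$, its adjoint $\mathcal{E}^\dagger$ has Kraus operators $\{E_i^\dagger\}$. - A super-operator or operator on a subsystem $\mathcal{H}_{\bar q}$ is identified with its tensor extension by the identity to $\mathcal{H}_{\mathcal{V}}$. A scalar $p\in[0,1]$ is identified with $p$ times the identity super-operator. - For super-operators, $\mathcal{E}\preceq\mathcal{F}$ iff $\mathcal{F}=\mathcal{E}+\mathcal{G}$ for some super-operator $\mathcal{G}$. - Operations on elements extend element-wise to sets, e.g. $\mathbb{E}\circ\mathcal{E}+\mathbb{F}\circ\mathcal{F}=\{\mathcal{E}'\circ\mathcal{E}+\mathcal{F}'\circ\mathcal{F}:\mathcal{E}'\in\mathbb{E},\mathcal{F}'\in\mathbb{F}\}$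 and $\mathcal{E}(\Theta)=\{\mathcal{E}(M):M\in\Theta\}$. Programs are given by $$S::=\mathbf{skip}\mid\mathbf{abort}\mid\bar q:=0\mid\bar q\mathrel{*}=U\mid S_0;S_1\mid S_0\,\square\,S_1\mid\mathbf{if}\ \mathcal{M}[\bar q]\ \mathbf{then}\ S_1\ \mathbf{else}\ S_0\ \mathbf{end}\mid\mathbf{while}\ \mathcal{M}[\bar q]\ \mathbf{do}\ S\ \mathbf{end},$$ where $\bar q=q_1,\dots,q_n$ are distinct variables, $U$ is a unitary on $\mathcal{H}_{\bar q}$, and $\mathcal{M}=\{P^0,P^1\}$ is a two-outcome projective measurement on $\mathcal{H}_{\bar q}$. Define - $\mathcal{P}^i_{\bar q}(\rho)=P^i_{\bar q}\rho P^i_{\bar q}$, - $\mathrm{Set}^0_{\bar q}(\rho)=\sum_{i=0}^{2^n-1}|0\rangle_{\bar q}\langle i|\rho|i\rangle_{\bar q}\langle0|$, - $\mathcal{U}_{\bar q}(\rho)=U_{\bar q}\rho U_{\bar q}^\dagger$. The denotational semantics $[\![S]\!]$ is a set of super-operators on $\mathcal{H}_{\mathcal{V}}$: - $[\![\mathbf{skip}]\!]=\{1\}$ and $[\![\mathbf{abort}]\!]=\{0\}$; - $[\![\bar q:=0]\!]=\{\mathrm{Set}^0_{\bar q}\}$ and $[\![\bar q\mathrel{*}=U]\!]=\{\mathcal{U}_{\bar q}\}$; - $[\![S_0;S_1]\!]=[\![S_1]\!]\circ[\![S_0]\!]$ and $[\![S_0\square S_1]\!]=[\![S_0]\!]\cup[\![S_1]\!]$;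 - $[\![\mathbf{if}\ \mathcal{M}[\bar q]\ \mathbf{then}\ S_1\ \mathbf{else}\ S_0\ \mathbf{end}]\!]=[\![S_0]\!]\circ\mathcal{P}^0_{\bar q}+[\![S_1]\!]\circ\mathcal{P}^1_{\bar q}$; - $[\![\mathbf{while}\ \mathcal{M}[\bar q]\ \mathbf{do}\ S\ \mathbf{end}]\!]=\{\sum_{i=0}^\infty\mathcal{P}^0_{\bar q}\circ\eta_i\circ\mathcal{P}^1_{\bar q}\circ\cdots\circ\eta_1\circ\mathcal{P}^1_{\bar q}:\eta\in[\![S]\!]^{\mathbb{N}}\}$, where a scheduler $\eta=(\eta_1,\eta_2,\dots)$ is a sequence of elements of $[\![S]\!]$ and the $i=0$ term is $\mathcal{P}^0_{\bar q}$. Write $[\![S]\!](\rho)=\{\mathcal{E}(\rho):\mathcal{E}\in[\![S]\!]\}$. Assertions. - A quantum predicate is an operator $M$ on $\mathcal{H}_{\mathcal{V}}$ with $0\sqsubseteq M\sqsubseteq I$. - A quantum assertion is any set of quantum predicates. A singleton $\{M\}$ is written $M$. - $\mathrm{Exp}(\rho\models\Theta)=\inf_{M\in\Theta}\mathrm{tr}(M\rho)$. - $\models_{\mathrm{par}}\{\Theta\}S\{\Psi\}$ means that for all $\rho\in\mathcal{D}(\mathcal{H}_{\mathcal{V}})$, $\mathrm{Exp}(\rho\models\Theta)\le\inf\{\mathrm{Exp}(\sigma\models\Psi)+\mathrm{tr}(\rho)-\mathrm{tr}(\sigma):\sigma\in[\![S]\!](\rho)\}$. - $\Theta\le_{\mathit{inf}}\Psi$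 means that for all $\rho\in\mathcal{D}(\mathcal{H}_{\mathcal{V}})$, $\inf_{M\in\Theta}\mathrm{tr}(M\rho)\le\inf_{N\in\Psi}\mathrm{tr}(N\rho)$. Proof system for partial correctness (axioms and rules): - (Skip) $\{\Theta\}\mathbf{skip}\{\Theta\}$. - (Abort) $\{I\}\mathbf{abort}\{0\}$. - (Init) $\{\sum_{i=0}^{2^n-1}|i\rangle_{\bar q}\langle0|\Theta|0\rangle_{\bar q}\langle i|\}\ \bar q:=0\ \{\Theta\}$. - (Unit) $\{U^\dagger_{\bar q}\Theta U_{\bar q}\}\ \bar q\mathrel{*}=U\ \{\Theta\}$. - (Seq) from $\{\Theta\}S_0\{\Theta'\}$ and $\{\Theta'\}S_1\{\Psi\}$ infer $\{\Theta\}S_0;S_1\{\Psi\}$. - (NDet) from $\{\Theta\}S_0\{\Psi\}$ and $\{\Theta\}S_1\{\Psi\}$ infer $\{\Theta\}S_0\square S_1\{\Psi\}$. - (Meas) from $\{\Theta_1\}S_1\{\Psi\}$ and $\{\Theta_0\}S_0\{\Psi\}$ infer $\{\mathcal{P}^0_{\bar q}(\Theta_0)+\mathcal{P}^1_{\bar q}(\Theta_1)\}\ \mathbf{if}\ \mathcal{M}[\bar q]\ \mathbf{then}\ S_1\ \mathbf{else}\ S_0\ \mathbf{end}\ \{\Psi\}$. - (While) from $\{\Theta\}S\{\mathcal{P}^0_{\bar q}(\Psi)+\mathcal{P}^1_{\bar q}(\Theta)\}$ infer $\{\mathcal{P}^0_{\bar q}(\Psi)+\mathcal{P}^1_{\bar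 q}(\Theta)\}\ \mathbf{while}\ \mathcal{M}[\bar q]\ \mathbf{do}\ S\ \mathbf{end}\ \{\Psi\}$. - (Imp) from $\Theta\le_{\mathit{inf}}\Theta'$, $\{\Theta'\}S\{\Psi'\}$ and $\Psi'\le_{\mathit{inf}}\Psi$ infer $\{\Theta\}S\{\Psi\}$. - (Union) from $\{\Theta_i\}S\{\Psi_i\}$ for all $i\in I$ (an arbitrary index set) infer $\{\bigcup_{i\in I}\Theta_i\}S\{\bigcup_{i\in I}\Psi_i\}$.
   Formalization: Rule (While) additionally requires Θ ≠ ∅: for Θ = ∅ its premise becomes {∅}S{∅}, which is derivable, but its conclusion {∅} while … {Ψ} is invalid for nonempty Ψ (the infimum over ∅ is +∞), so the system as stated is unsound. *)

theory Defs
  imports "HOL-Analysis.Analysis" "Jordan_Normal_Form.Schur_Decomposition"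
begin

no_notation vec_index (infixl "$" 100)

text \<open>
  The finite type \<open>'q\<close> is the set of all qubit variables.  The computational basis of the global
  space is the set of all assignments \<open>'q \<Rightarrow> bool\<close>, and operators on the global space are the
  matrices in that basis.  Operators on the subsystem of a register \<open>qs = [q\<^sub>1, \<dots>, q\<^sub>n]\<close> are
  \<open>2 ^ n \<times> 2 ^ n\<close> matrices, whose size depends on the register and is therefore not a type.
\<close>

type_synonym 'q state = "'q \<Rightarrow> bool"
type_synonym 'q qop = "complex ^ 'q state ^ 'q state"
type_synonym 'q superop = "'q qop \<Rightarrow> 'q qop"

definition adj :: "('q :: finite) qop \<Rightarrow> 'q qop" where
  "adj A = map_matrix cnj (Finite_Cartesian_Product.transpose A)"

definition positive :: "('q :: finite) qop \<Rightarrow> bool" where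
  "positive A \<longleftrightarrow> (\<forall>v. (\<Sum>s\<in>UNIV. cnj (v $ s) * (A *v v) $ s) \<in> \<real>\<^sub>\<ge>\<^sub>0)"

definition loewner :: "('q :: finite) qop \<Rightarrow> 'q qop \<Rightarrow> bool" (infix "\<sqsubseteq>\<^sub>L" 50) where
  "A \<sqsubseteq>\<^sub>L B \<longleftrightarrow> positive (B - A)"

text \<open>The traces used below are real, since they are traces of (products of two) positive operators.\<close>

definition rtrace :: "('q :: finite) qop \<Rightarrow> real" where
  "rtrace A = Re (trace A)"

definition density :: "('q :: finite) qop \<Rightarrow> bool" where
  "density \<rho> \<longleftrightarrow> positive \<rho> \<and> rtrace \<rho> \<le> 1"

text \<open>
  \<open>basis_index qs s\<close> is the number whose binary digits are \<open>s q\<^sub>1, \<dots>, s q\<^sub>n\<close>, with \<open>s q\<^sub>1\<close> the most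
  significant one (\<open>horner_sum\<close> itself takes the least significant digit first).
\<close>

definition basis_index :: "'q list \<Rightarrow> 'q state \<Rightarrow> nat" where
  "basis_index qs s = horner_sum of_bool 2 (rev (map s qs))"

text \<open>
  The tensor product of an operator on the register \<open>qs\<close> with the identity on all other variables.
\<close>

definition cyl :: "('q :: finite) list \<Rightarrow> complex Matrix.mat \<Rightarrow> 'q qop" where
  "cyl qs A = (\<chi> s t. if \<forall>q. q \<notin> set qs \<longrightarrow> s q = t q
                       then A $$ (basis_index qs s, basis_index qs t) else 0)"

definition ketbra :: "('q :: finite) list \<Rightarrow> nat \<Rightarrow> nat \<Rightarrow> 'q qop" where
  "ketbra qs i j =
     cyl qs (Matrix.mat (2 ^ length qs) (2 ^ length qs) (\<lambda>(k, l). of_bool (k = i \<and> l = j)))"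

definition is_unitary :: "nat \<Rightarrow> complex Matrix.mat \<Rightarrow> bool" where
  "is_unitary d U \<longleftrightarrow> U \<in> carrier_mat d d \<and> mat_adjoint U * U = 1\<^sub>m d \<and> U * mat_adjoint U = 1\<^sub>m d"

definition is_projector :: "nat \<Rightarrow> complex Matrix.mat \<Rightarrow> bool" where
  "is_projector d P \<longleftrightarrow> P \<in> carrier_mat d d \<and> mat_adjoint P = P \<and> P * P = P"

text \<open>The orthogonality \<open>P0 * P1 = 0\<close> follows from the completeness equation.\<close>

definition is_projective_measurement :: "nat \<Rightarrow> complex Matrix.mat \<Rightarrow> complex Matrix.mat \<Rightarrow> bool" where
  "is_projective_measurement d P0 P1 \<longleftrightarrow>
     is_projector d P0 \<and> is_projector d P1 \<and> P0 + P1 = 1\<^sub>m d"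

definition proj_op :: "('q :: finite) list \<Rightarrow> complex Matrix.mat \<Rightarrow> 'q superop" where
  "proj_op qs P = (\<lambda>\<rho>. cyl qs P ** \<rho> ** cyl qs P)"

definition set0_op :: "('q :: finite) list \<Rightarrow> 'q superop" where
  "set0_op qs = (\<lambda>\<rho>. \<Sum>i<2 ^ length qs. ketbra qs 0 i ** \<rho> ** ketbra qs i 0)"

definition unitary_op :: "('q :: finite) list \<Rightarrow> complex Matrix.mat \<Rightarrow> 'q superop" where
  "unitary_op qs U = (\<lambda>\<rho>. cyl qs U ** \<rho> ** adj (cyl qs U))"

text \<open>
  \<open>Cond P0 P1 qs S1 S0\<close> is \<open>if M[qs] then S1 else S0 end\<close> and \<open>While P0 P1 qs S\<close> is
  \<open>while M[qs] do S end\<close>, for the measurement \<open>M = {P0, P1}\<close>.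
\<close>

datatype 'q prog =
    Skip
  | Abort
  | Init "'q list"
  | Unitary "'q list" "complex Matrix.mat"
  | Seq "'q prog" "'q prog"
  | NDet "'q prog" "'q prog"
  | Cond "complex Matrix.mat" "complex Matrix.mat" "'q list" "'q prog" "'q prog"
  | While "complex Matrix.mat" "complex Matrix.mat" "'q list" "'q prog"

primrec wf_prog :: "'q prog \<Rightarrow> bool" where
  "wf_prog Skip \<longleftrightarrow> True"
| "wf_prog Abort \<longleftrightarrow> True"
| "wf_prog (Init qs) \<longleftrightarrow> distinct qs"
| "wf_prog (Unitary qs U) \<longleftrightarrow> distinct qs \<and> is_unitary (2 ^ length qs) U"
| "wf_prog (Seq S0 S1) \<longleftrightarrow> wf_prog S0 \<and> wf_prog S1"
| "wf_prog (NDet S0 S1) \<longleftrightarrow> wf_prog S0 \<and> wf_prog S1"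
| "wf_prog (Cond P0 P1 qs S1 S0) \<longleftrightarrow>
     distinct qs \<and> is_projective_measurement (2 ^ length qs) P0 P1 \<and> wf_prog S1 \<and> wf_prog S0"
| "wf_prog (While P0 P1 qs S) \<longleftrightarrow>
     distinct qs \<and> is_projective_measurement (2 ^ length qs) P0 P1 \<and> wf_prog S"

text \<open>
  \<open>sched_iter \<P> \<eta> i\<close> is the composition \<open>\<eta>\<^sub>i \<circ> \<P> \<circ> \<dots> \<circ> \<eta>\<^sub>1 \<circ> \<P>\<close>; schedulers are indexed from 0 here, so
  \<open>\<eta> k\<close> is the element \<open>\<eta>\<^sub>k\<^sub>+\<^sub>1\<close>.
\<close>

primrec sched_iter :: "('q :: finite) superop \<Rightarrow> (nat \<Rightarrow> 'q superop) \<Rightarrow> nat \<Rightarrow> 'q superop" where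
  "sched_iter \<P> \<eta> 0 = id"
| "sched_iter \<P> \<eta> (Suc i) = \<eta> i \<circ> \<P> \<circ> sched_iter \<P> \<eta> i"

text \<open>
  The series in the clause for loops is taken pointwise, in the finite-dimensional space of
  matrices.
\<close>

primrec sem :: "('q :: finite) prog \<Rightarrow> 'q superop set" where
  "sem Skip = {id}"
| "sem Abort = {\<lambda>\<rho>. 0}"
| "sem (Init qs) = {set0_op qs}"
| "sem (Unitary qs U) = {unitary_op qs U}"
| "sem (Seq S0 S1) = {\<F> \<circ> \<E> |\<E> \<F>. \<E> \<in> sem S0 \<and> \<F> \<in> sem S1}"
| "sem (NDet S0 S1) = sem S0 \<union> sem S1"
| "sem (Cond P0 P1 qs S1 S0) =
     {\<lambda>\<rho>. \<E> (proj_op qs P0 \<rho>) + \<F> (proj_op qs P1 \<rho>) |\<E> \<F>. \<E> \<in> sem S0 \<and> \<F> \<in> sem S1}"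
| "sem (While P0 P1 qs S) =
     {\<lambda>\<rho>. \<Sum>i. proj_op qs P0 (sched_iter (proj_op qs P1) \<eta> i \<rho>) |\<eta>. \<forall>k. \<eta> k \<in> sem S}"

definition predicate :: "('q :: finite) qop \<Rightarrow> bool" where
  "predicate M \<longleftrightarrow> 0 \<sqsubseteq>\<^sub>L M \<and> M \<sqsubseteq>\<^sub>L Finite_Cartesian_Product.mat 1"

definition assertion :: "('q :: finite) qop set \<Rightarrow> bool" where
  "assertion \<Theta> \<longleftrightarrow> (\<forall>M\<in>\<Theta>. predicate M)"

text \<open>Extended reals, since assertions may be empty: the infimum of the empty set is \<open>\<infinity>\<close>.\<close>

definition Exp :: "('q :: finite) qop \<Rightarrow> 'q qop set \<Rightarrow> ereal" where
  "Exp \<rho> \<Theta> = (INF M\<in>\<Theta>. ereal (rtrace (M ** \<rho>)))"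

definition valid_par :: "('q :: finite) qop set \<Rightarrow> 'q prog \<Rightarrow> 'q qop set \<Rightarrow> bool" where
  "valid_par \<Theta> S \<Psi> \<longleftrightarrow>
     (\<forall>\<rho>. density \<rho> \<longrightarrow>
        Exp \<rho> \<Theta> \<le> (INF \<sigma>\<in>{\<E> \<rho> |\<E>. \<E> \<in> sem S}. Exp \<sigma> \<Psi> + ereal (rtrace \<rho>) - ereal (rtrace \<sigma>)))"

definition le_inf :: "('q :: finite) qop set \<Rightarrow> 'q qop set \<Rightarrow> bool" (infix "\<le>\<^sub>i\<^sub>n\<^sub>f" 50) where
  "\<Theta> \<le>\<^sub>i\<^sub>n\<^sub>f \<Psi> \<longleftrightarrow> (\<forall>\<rho>. density \<rho> \<longrightarrow> Exp \<rho> \<Theta> \<le> Exp \<rho> \<Psi>)"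

definition meas_sum :: "complex Matrix.mat \<Rightarrow> complex Matrix.mat \<Rightarrow> ('q :: finite) list \<Rightarrow>
    'q qop set \<Rightarrow> 'q qop set \<Rightarrow> 'q qop set" where
  "meas_sum P0 P1 qs \<Theta>0 \<Theta>1 = {proj_op qs P0 M + proj_op qs P1 N |M N. M \<in> \<Theta>0 \<and> N \<in> \<Theta>1}"

text \<open>
  Rule \<open>While\<close> requires a nonempty \<open>\<Theta>\<close>.  For \<open>\<Theta> = {}\<close> the element-wise sum is empty as well, so the
  premise of the rule would be \<open>{\<emptyset>} S {\<emptyset>}\<close>, which always holds, and its conclusion
  \<open>{\<emptyset>} while M[qs] do S end {\<Psi>}\<close>, which fails for every nonempty \<open>\<Psi>\<close>.

  In rule \<open>Union\<close> the family of pairs of assertions is given by its range \<open>F\<close>; the form with an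
  arbitrary index set is lemma \<open>derivable_UN\<close> below.
\<close>

inductive derivable :: "('q :: finite) qop set \<Rightarrow> 'q prog \<Rightarrow> 'q qop set \<Rightarrow> bool" where
  Skip: "assertion \<Theta> \<Longrightarrow> derivable \<Theta> Skip \<Theta>"
| Abort: "derivable {Finite_Cartesian_Product.mat 1} Abort {0}"
| Init: "assertion \<Theta> \<Longrightarrow>
    derivable ((\<lambda>M. \<Sum>i<2 ^ length qs. ketbra qs i 0 ** M ** ketbra qs 0 i) ` \<Theta>) (Init qs) \<Theta>"
| Unit: "assertion \<Theta> \<Longrightarrow>
    derivable ((\<lambda>M. adj (cyl qs U) ** M ** cyl qs U) ` \<Theta>) (Unitary qs U) \<Theta>"
| Seq: "derivable \<Theta> S0 \<Theta>' \<Longrightarrow> derivable \<Theta>' S1 \<Psi> \<Longrightarrow> derivable \<Theta> (Seq S0 S1) \<Psi>"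
| NDet: "derivable \<Theta> S0 \<Psi> \<Longrightarrow> derivable \<Theta> S1 \<Psi> \<Longrightarrow> derivable \<Theta> (NDet S0 S1) \<Psi>"
| Meas: "derivable \<Theta>1 S1 \<Psi> \<Longrightarrow> derivable \<Theta>0 S0 \<Psi> \<Longrightarrow>
    derivable (meas_sum P0 P1 qs \<Theta>0 \<Theta>1) (Cond P0 P1 qs S1 S0) \<Psi>"
| While: "assertion \<Psi> \<Longrightarrow> \<Theta> \<noteq> {} \<Longrightarrow> derivable \<Theta> S (meas_sum P0 P1 qs \<Psi> \<Theta>) \<Longrightarrow>
    derivable (meas_sum P0 P1 qs \<Psi> \<Theta>) (While P0 P1 qs S) \<Psi>"
| Imp: "assertion \<Theta> \<Longrightarrow> assertion \<Psi> \<Longrightarrow>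
    \<Theta> \<le>\<^sub>i\<^sub>n\<^sub>f \<Theta>' \<Longrightarrow> derivable \<Theta>' S \<Psi>' \<Longrightarrow> \<Psi>' \<le>\<^sub>i\<^sub>n\<^sub>f \<Psi> \<Longrightarrow> derivable \<Theta> S \<Psi>"
| Union: "(\<And>\<Theta> \<Psi>. (\<Theta>, \<Psi>) \<in> F \<Longrightarrow> derivable \<Theta> S \<Psi>) \<Longrightarrow>
    derivable (\<Union>(\<Theta>, \<Psi>)\<in>F. \<Theta>) S (\<Union>(\<Theta>, \<Psi>)\<in>F. \<Psi>)"

lemma derivable_UN:
  assumes "\<And>i. i \<in> I \<Longrightarrow> derivable (\<Theta> i) S (\<Psi> i)"
  shows "derivable (\<Union>i\<in>I. \<Theta> i) S (\<Union>i\<in>I. \<Psi> i)"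
  using derivable.Union[of "(\<lambda>i. (\<Theta> i, \<Psi> i)) ` I" S] assms by auto

end

theory Submission
  imports Defs
begin

text \<open>
  A super-operator \<open>\<E>\<close> and a predicate \<open>M\<close> have a weakest liberal precondition, the predicate \<open>N\<close> with
  \<open>tr (N \<rho>) = tr (M \<E>(\<rho>)) + tr \<rho> - tr \<E>(\<rho>)\<close> for all positive \<open>\<rho>\<close>.  Collecting these over
  \<open>\<E> \<in> \<lbrakk>S\<rbrakk>\<close> and \<open>M \<in> \<Psi>\<close> gives an assertion \<open>wlp S \<Psi>\<close> such that \<open>{\<Theta>} S {\<Psi>}\<close> is valid iff
  \<open>\<Theta> \<le>\<^sub>i\<^sub>n\<^sub>f wlp S \<Psi>\<close>, so by rule (Imp) completeness amounts to deriving \<open>{wlp S \<Psi>} S {\<Psi>}\<close>.  In a branching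
  or looping statement all branches must refer to the same \<open>M \<in> \<Psi>\<close>, hence these cases are proved for
  singletons \<open>{M}\<close> and combined by rule (Union).  For \<open>W = wlp (while) {M}\<close>, the loop is derived from
  \<open>\<Theta> = wlp S W\<close>, since \<open>P0 M P0 + P1 N P1\<close> with \<open>N \<in> \<Theta>\<close> is the unfolding of an element of \<open>W\<close>.
\<close>

section \<open>Positive matrices\<close>

definition hdot :: "complex ^ 'n \<Rightarrow> complex ^ 'n \<Rightarrow> complex" where
  "hdot u v = (\<Sum>i\<in>UNIV. cnj (u $ i) * v $ i)"

definition outer :: "complex ^ 'n \<Rightarrow> complex ^ 'n ^ 'n" where
  "outer v = (\<chi> i j. v $ i * cnj (v $ j))"

lemma positive_iff_hdot: "positive A \<longleftrightarrow> (\<forall>v. hdot v (A *v v) \<in> \<real>\<^sub>\<ge>\<^sub>0)"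
  by (simp add: positive_def hdot_def)

lemma hdot_add_left: "hdot (u + w) v = hdot u v + hdot w v"
  and hdot_add_right: "hdot u (v + w) = hdot u v + hdot u w"
  and hdot_diff_left: "hdot (u - w) v = hdot u v - hdot w v"
  and hdot_diff_right: "hdot u (v - w) = hdot u v - hdot u w"
  and hdot_scale_left: "hdot (c *s u) v = cnj c * hdot u v"
  and hdot_scale_right: "hdot u (c *s v) = c * hdot u v"
  by (simp_all add: hdot_def algebra_simps sum.distrib sum_subtractf sum_distrib_left)

lemma hdot_commute: "hdot v u = cnj (hdot u v)"
  by (simp add: hdot_def mult.commute)

lemma hdot_self: "hdot v v = of_real ((norm v)\<^sup>2)"
proof -
  have "(norm v)\<^sup>2 = (\<Sum>i\<in>UNIV. (cmod (v $ i))\<^sup>2)"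
    by (simp add: norm_vec_def L2_set_def sum_nonneg)
  then show ?thesis
    by (simp add: hdot_def complex_norm_square mult.commute del: of_real_power)
qed

lemma hdot_axis_left: "hdot (axis s 1) v = v $ s"
proof -
  have "hdot (axis s 1) v = (\<Sum>i\<in>UNIV. if i = s then v $ i else 0)"
    unfolding hdot_def by (intro sum.cong) (auto simp: axis_def)
  then show ?thesis by simp
qed

lemma matrix_vector_mult_axis: "(A *v axis t 1) $ s = (A $ s $ t :: 'a :: comm_semiring_1)"
proof -
  have "(A *v axis t 1) $ s = (\<Sum>j\<in>UNIV. A $ s $ j * (if j = t then 1 else 0))"
    by (simp add: matrix_vector_mult_def axis_def)
  also have "\<dots> = (\<Sum>j\<in>UNIV. if j = t then A $ s $ j else 0)"
    by (intro sum.cong) auto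
  finally have "(A *v axis t 1) $ s = (\<Sum>j\<in>UNIV. if j = t then A $ s $ j else 0)" .
  then show ?thesis by simp
qed

lemma outer_mult_vec: "outer b *v v = hdot b v *s b"
  by (simp add: Finite_Cartesian_Product.vec_eq_iff outer_def matrix_vector_mult_def hdot_def sum_distrib_left
      sum_distrib_right mult_ac)

section \<open>The cone of positive operators\<close>

lemma positive_0: "positive 0"
  by (simp add: positive_def)

lemma positive_one: "positive (Finite_Cartesian_Product.mat 1)"
  by (simp add: positive_iff_hdot hdot_self del: of_real_power)

lemma positive_add: "positive A \<Longrightarrow> positive B \<Longrightarrow> positive (A + B)"
  by (auto simp: positive_iff_hdot matrix_vector_mult_add_rdistrib hdot_add_right
      intro: nonneg_Reals_add_I)

lemma positive_sum: "(\<And>i. i \<in> I \<Longrightarrow> positive (f i)) \<Longrightarrow> positive (\<Sum>i\<in>I. f i)"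
  by (induction I rule: infinite_finite_induct) (auto simp: positive_0 positive_add)

lemma hdot_mult_vec: "hdot u (A *v v) = hdot (adj A *v u) v"
proof -
  have "hdot u (A *v v) = (\<Sum>i\<in>UNIV. \<Sum>j\<in>UNIV. cnj (u $ i) * (A $ i $ j * v $ j))"
    by (simp add: hdot_def matrix_vector_mult_def sum_distrib_left)
  also have "\<dots> = (\<Sum>j\<in>UNIV. \<Sum>i\<in>UNIV. cnj (u $ i) * (A $ i $ j * v $ j))"
    by (rule sum.swap)
  also have "\<dots> = hdot (adj A *v u) v"
    by (simp add: hdot_def matrix_vector_mult_def adj_def map_matrix_def
        Finite_Cartesian_Product.transpose_def sum_distrib_left
        sum_distrib_right mult_ac)
  finally show ?thesis .
qed

lemma adj_adj [simp]: "adj (adj A) = A"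
  by (simp add: adj_def map_matrix_def Finite_Cartesian_Product.transpose_def Finite_Cartesian_Product.vec_eq_iff)

lemma positive_conj: "positive A \<Longrightarrow> positive (K ** A ** adj K)"
  by (simp add: positive_iff_hdot hdot_mult_vec[of _ K] flip: matrix_vector_mul_assoc)

text \<open>Polarization: the quadratic form of \<open>A\<close> is real at \<open>u + v\<close> and
  at \<open>u + \<i> *s v\<close>, which gives the imaginary and the real part of the
  identity.\<close>

lemma positive_hdot_commute:
  assumes "positive A"
  shows "hdot v (A *v u) = cnj (hdot u (A *v v))"
proof -
  define p q where "p = hdot u (A *v v)" and "q = hdot v (A *v u)"
  have real: "Im (hdot w (A *v w)) = 0" for w
    using assms by (auto simp: positive_iff_hdot complex_nonneg_Reals_iff)
  have "hdot (u + v) (A *v (u + v)) = hdot u (A *v u) + p + q + hdot v (A *v v)"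
    by (simp add: p_def q_def matrix_vector_right_distrib hdot_add_left hdot_add_right)
  from arg_cong[OF this, of Im] have im: "Im p + Im q = 0"
    by (simp add: real)
  have "hdot (u + \<i> *s v) (A *v (u + \<i> *s v)) = hdot u (A *v u) + \<i> * p - \<i> * q + hdot v (A *v v)"
    by (simp add: p_def q_def matrix_vector_right_distrib hdot_add_left hdot_add_right
        vector_scalar_commute hdot_scale_left hdot_scale_right algebra_simps)
  from arg_cong[OF this, of Im] have "Re p = Re q"
    by (simp add: real)
  with im show ?thesis
    by (simp add: complex_eq_iff flip: p_def q_def)
qed

lemma positive_hermitian: "positive A \<Longrightarrow> A $ t $ s = cnj (A $ s $ t)"
  using positive_hdot_commute[of A "axis t 1" "axis s 1"]
  by (simp add: hdot_axis_left matrix_vector_mult_axis)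

lemma positive_diag: "positive A \<Longrightarrow> A $ s $ s \<in> \<real>\<^sub>\<ge>\<^sub>0"
  unfolding positive_iff_hdot
  by (drule spec[of _ "axis s 1"]) (simp add: hdot_axis_left matrix_vector_mult_axis)

text \<open>Apart from a term in |c|^2 with coefficient \<open>A $ s $ s\<close>, the form is
  real-affine in \<open>c\<close>. A zero diagonal entry leaves only the affine part, a positive one
  allows completing the square.\<close>

lemma hdot_minus_axis:
  fixes A :: "('q :: finite) qop"
  assumes "positive A"
  shows "hdot (v - c *s axis s 1) (A *v (v - c *s axis s 1)) =
    hdot v (A *v v) - c * cnj ((A *v v) $ s) - cnj c * (A *v v) $ s + c * cnj c * A $ s $ s"
proof -
  have "hdot v (A *v axis s 1) = cnj ((A *v v) $ s)"
    by (simp add: positive_hdot_commute[OF assms, of v] hdot_axis_left)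
  then show ?thesis
    by (simp add: matrix_vector_mult_diff_distrib vector_scalar_commute hdot_diff_left
        hdot_diff_right hdot_scale_left hdot_scale_right hdot_axis_left matrix_vector_mult_axis
        algebra_simps)
qed

text \<open>Shifting \<open>v\<close> along \<open>axis s 1\<close> changes the form by a linear
  term only. If that term did not vanish, the form would take negative values.\<close>

lemma positive_diag_0_mult_vec:
  fixes A :: "('q :: finite) qop"
  assumes "positive A" and "A $ s $ s = 0"
  shows "(A *v v) $ s = 0"
proof (rule ccontr)
  define z where "z = (A *v v) $ s"
  assume "(A *v v) $ s \<noteq> 0"
  then have z: "(cmod z)\<^sup>2 > 0" by (simp add: z_def)
  \<comment> \<open>Chosen so that the real part of the form at the shifted vector is -1.\<close>
  define r where "r = (Re (hdot v (A *v v)) + 1) / (2 * (cmod z)\<^sup>2)"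
  define c where "c = of_real r * z"
  have "hdot (v - c *s axis s 1) (A *v (v - c *s axis s 1)) =
      hdot v (A *v v) - of_real (2 * r * (cmod z)\<^sup>2)"
    using assms by (simp add: hdot_minus_axis c_def complex_norm_square del: of_real_power flip: z_def)
  moreover have "hdot (v - c *s axis s 1) (A *v (v - c *s axis s 1)) \<in> \<real>\<^sub>\<ge>\<^sub>0"
    using assms by (simp add: positive_iff_hdot)
  ultimately have "Re (hdot v (A *v v)) - 2 * r * (cmod z)\<^sup>2 \<ge> 0"
    by (simp add: complex_nonneg_Reals_iff)
  moreover have "2 * r * (cmod z)\<^sup>2 = Re (hdot v (A *v v)) + 1"
    using z by (simp add: r_def)
  ultimately show False by simp
qed

text \<open>One step of the Cholesky decomposition.\<close>

lemma positive_minus_outer: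
  fixes A :: "('q :: finite) qop"
  assumes A: "positive A" and s: "A $ s $ s = of_real a" "a > 0"
  defines "b \<equiv> (\<chi> i. A $ i $ s / of_real (sqrt a))"
  shows "positive (A - outer b)"
  unfolding positive_iff_hdot
proof
  fix v
  define z where "z = (A *v v) $ s"
  \<comment> \<open>Completes the square: shifting by this \<open>c\<close> lowers the form by |z|^2
    / a, the amount that \<open>outer b\<close> contributes at \<open>v\<close>.\<close>
  define c where "c = z / of_real a"
  have "hdot b v = z / of_real (sqrt a)"
    using positive_hermitian[OF A, of s]
    by (simp add: hdot_def b_def z_def matrix_vector_mult_def sum_divide_distrib)
  then have "hdot v (outer b *v v) = z * cnj z / (of_real (sqrt a) * of_real (sqrt a))"
    using hdot_commute[of v b] by (simp add: outer_mult_vec hdot_scale_right)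
  also have "of_real (sqrt a) * of_real (sqrt a) = (of_real a :: complex)"
    using s by (simp flip: of_real_mult)
  finally have "hdot v ((A - outer b) *v v) = hdot v (A *v v) - z * cnj z / of_real a"
    by (simp add: matrix_vector_mult_diff_rdistrib hdot_diff_right)
  also have "\<dots> = hdot (v - c *s axis s 1) (A *v (v - c *s axis s 1))"
    using s by (simp add: hdot_minus_axis[OF A] c_def field_simps flip: z_def)
  also have "\<dots> \<in> \<real>\<^sub>\<ge>\<^sub>0"
    using A by (simp add: positive_iff_hdot)
  finally show "hdot v ((A - outer b) *v v) \<in> \<real>\<^sub>\<ge>\<^sub>0" .
qed

text \<open>Subtracting a suitable outer product clears one nonzero diagonal entry of a positive
  matrix and creates no new one, so finitely many steps reach 0. The induction reduces claims to
  rank-one matrices, in place of the spectral theorem.\<close>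

lemma positive_induct [consumes 1, case_names zero outer]:
  fixes A :: "('q :: finite) qop"
  assumes "positive A" and "P 0" and add: "\<And>A v. P A \<Longrightarrow> P (A + outer v)"
  shows "P A"
  using \<open>positive A\<close>
proof (induction "card {s. A $ s $ s \<noteq> 0}" arbitrary: A rule: less_induct)
  case less
  note A = \<open>positive A\<close>
  \<comment> \<open>A zero diagonal entry of a positive matrix forces its whole column to
    vanish.\<close>
  have zero: "A $ t $ s = 0" if "A $ s $ s = 0" for s t
    using positive_diag_0_mult_vec[OF A that, of "axis t 1"] positive_hermitian[OF A, of t s]
    by (simp add: matrix_vector_mult_axis)
  show ?case
  proof (cases "\<exists>s. A $ s $ s \<noteq> 0")
    case False
    then have "A = 0" using zero by (simp add: Finite_Cartesian_Product.vec_eq_iff)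
    with \<open>P 0\<close> show ?thesis by simp
  next
    case True
    then obtain s where s0: "A $ s $ s \<noteq> 0" by blast
    from positive_diag[OF A, of s] obtain a where a: "A $ s $ s = of_real a" "a \<ge> 0"
      by (auto elim!: nonneg_Reals_cases)
    with s0 have "a > 0" by (cases "a = 0") auto
    \<comment> \<open>Column \<open>s\<close>, scaled so that \<open>outer b\<close> agrees with
      \<open>A\<close> in row and column \<open>s\<close>.\<close>
    define b :: "complex ^ 'q state" where "b = (\<chi> i. A $ i $ s / of_real (sqrt a))"
    define B where "B = A - outer b"
    have "positive B"
      using positive_minus_outer[OF A a(1) \<open>a > 0\<close>] by (simp add: B_def b_def)
    have "of_real (sqrt a) * of_real (sqrt a) = (of_real a :: complex)"
      using a by (simp flip: of_real_mult)
    then have "B $ s $ s = 0"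
      using a \<open>a > 0\<close> by (simp add: B_def outer_def b_def field_simps)
    moreover have "B $ t $ t = 0" if "A $ t $ t = 0" for t
      using that zero[OF that, of s] positive_hermitian[OF A, of t s]
      by (simp add: B_def outer_def b_def)
    ultimately have "{t. B $ t $ t \<noteq> 0} \<subset> {t. A $ t $ t \<noteq> 0}"
      using s0 by blast
    then have "P B"
      using less.hyps \<open>positive B\<close> by (simp add: psubset_card_mono)
    from add[OF this, of b] show ?thesis by (simp add: B_def)
  qed
qed

section \<open>Traces and predicates\<close>

lemma linear_rtrace: "linear rtrace"
  by (rule linearI) (simp_all add: rtrace_def Determinants.trace_def sum.distrib
      sum_distrib_left)

lemma linear_matrix_mult: "linear ((**) M :: ('q :: finite) qop \<Rightarrow> 'q qop)"
  by (rule linearI) (simp_all add: matrix_add_ldistrib Finite_Cartesian_Product.vec_eq_iff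
      matrix_matrix_mult_def scaleR_sum_right sum.distrib distrib_left)

lemma rtrace_add: "rtrace (A + B) = rtrace A + rtrace B"
  and rtrace_diff: "rtrace (A - B) = rtrace A - rtrace B"
  and rtrace_sum: "rtrace (\<Sum>i\<in>I. f i) = (\<Sum>i\<in>I. rtrace (f i))"
  and rtrace_0 [simp]: "rtrace 0 = 0"
  by (rule linear_add[OF linear_rtrace] linear_diff[OF linear_rtrace]
      linear_sum[OF linear_rtrace] linear_0[OF linear_rtrace])+

lemma rtrace_mult_commute: "rtrace (A ** B) = rtrace (B ** A)"
  unfolding rtrace_def by (rule arg_cong[OF trace_mul_sym])

lemma matrix_add_rdistrib: "(B + C) ** A = B ** A + C ** (A :: 'a :: semiring_1 ^ 'n ^ 'm)"
  by (simp add: matrix_matrix_mult_def Finite_Cartesian_Product.vec_eq_iff distrib_right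
      sum.distrib)

lemma matrix_diff_ldistrib: "A ** (B - C) = A ** B - A ** (C :: 'a :: ring_1 ^ 'n ^ 'm)"
  and matrix_diff_rdistrib: "(B' - C') ** A' = B' ** A' - C' ** (A' :: 'a :: ring_1 ^ 'n ^ 'm)"
  by (simp_all add: matrix_matrix_mult_def Finite_Cartesian_Product.vec_eq_iff
      left_diff_distrib right_diff_distrib sum_subtractf)

lemma matrix_sum_ldistrib: "A ** (\<Sum>i\<in>I. f i) = (\<Sum>i\<in>I. A ** f i)"
  and matrix_sum_rdistrib: "(\<Sum>i\<in>I. f i) ** A = (\<Sum>i\<in>I. f i ** A)"
  for A :: "('q :: finite) qop"
  by (induction I rule: infinite_finite_induct)
    (simp_all add: matrix_add_ldistrib matrix_add_rdistrib)

lemma trace_mult_outer: "trace (M ** outer v) = hdot v (M *v v)"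
  by (simp add: Determinants.trace_def matrix_matrix_mult_def outer_def hdot_def
      matrix_vector_mult_def sum_distrib_left mult_ac)

text \<open>For a rank-one second factor the trace is the quadratic form of \<open>M\<close>;
  \<open>positive_induct\<close> extends this to sums.\<close>

lemma rtrace_mult_nonneg:
  assumes "positive M" and "positive A"
  shows "0 \<le> rtrace (M ** A)"
  using \<open>positive A\<close>
proof (induction rule: positive_induct)
  case (outer A v)
  have "0 \<le> rtrace (M ** outer v)"
    using \<open>positive M\<close>
    by (simp add: rtrace_def trace_mult_outer positive_iff_hdot complex_nonneg_Reals_iff)
  with outer show ?case by (simp add: matrix_add_ldistrib rtrace_add)
qed simp

lemma rtrace_nonneg: "positive A \<Longrightarrow> 0 \<le> rtrace A"
  using rtrace_mult_nonneg[OF positive_one] by simp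

text \<open>The norm is the Frobenius norm. At \<open>outer v\<close> both sides equal |v|^2, and
  the triangle inequality handles sums. The bound serves for boundedness of the predicates and for
  convergence of loop series.\<close>

lemma norm_le_rtrace:
  assumes "positive A"
  shows "norm A \<le> rtrace A"
  using assms
proof (induction rule: positive_induct)
  case (outer A v)
  have row: "norm (outer v $ i) = cmod (v $ i) * norm v" for i
    by (simp add: outer_def norm_vec_def norm_mult L2_set_right_distrib)
  have "norm (outer v) = L2_set (\<lambda>i. cmod (v $ i) * norm v) UNIV"
    unfolding norm_vec_def[of "outer v"] by (simp only: row)
  also have "\<dots> = (norm v)\<^sup>2"
    by (simp add: power2_eq_square norm_vec_def[of v] flip: L2_set_left_distrib)
  also have "\<dots> = rtrace (outer v)"
    using trace_mult_outer[of "Finite_Cartesian_Product.mat 1" v]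
    by (simp add: rtrace_def hdot_self del: of_real_power)
  finally have "norm (outer v) = rtrace (outer v)" .
  with outer norm_triangle_ineq[of A "outer v"] show ?case by (simp add: rtrace_add)
qed simp

section \<open>Predicates and limits of operators\<close>

lemma predicate_iff:
  "predicate M \<longleftrightarrow> positive M \<and> positive (Finite_Cartesian_Product.mat 1 - M)"
  by (simp add: predicate_def loewner_def)

lemma predicate_rtrace_mult:
  assumes "predicate M" and "positive A"
  shows "0 \<le> rtrace (M ** A)" and "rtrace (M ** A) \<le> rtrace A"
  using assms rtrace_mult_nonneg[of M A]
    rtrace_mult_nonneg[of "Finite_Cartesian_Product.mat 1 - M" A]
  by (simp_all add: predicate_iff matrix_diff_rdistrib rtrace_diff)

lemma predicate_0: "predicate 0" and predicate_one: "predicate (Finite_Cartesian_Product.mat 1)"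
  by (simp_all add: predicate_iff positive_0 positive_one)

lemma closed_positive: "closed {A. positive (A :: ('q :: finite) qop)}"
proof -
  have "continuous_on UNIV (\<lambda>A :: 'q qop. hdot v (A *v v))" for v
    unfolding hdot_def matrix_vector_mult_def vec_lambda_beta by (intro continuous_intros)
  then have "closed ((\<lambda>A :: 'q qop. hdot v (A *v v)) -` \<real>\<^sub>\<ge>\<^sub>0)" for v
    by (rule closed_vimage[OF closed_nonneg_Reals_complex])
  moreover have "{A :: 'q qop. positive A} = (\<Inter>v. (\<lambda>A. hdot v (A *v v)) -` \<real>\<^sub>\<ge>\<^sub>0)"
    by (auto simp: positive_iff_hdot)
  ultimately show ?thesis by (simp add: closed_INT)
qed

text \<open>Bounded because the norm of a predicate is at most its trace, hence at most the trace of
  the identity. Compactness later supplies the weakest liberal preconditions of loops.\<close>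

lemma compact_predicate: "compact {M. predicate (M :: ('q :: finite) qop)}"
proof -
  have eq: "{M :: 'q qop. predicate M} =
      {A. positive A} \<inter> (\<lambda>M. Finite_Cartesian_Product.mat 1 - M) -` {A. positive A}"
    by (auto simp: predicate_iff)
  have "continuous_on UNIV (\<lambda>M :: 'q qop. Finite_Cartesian_Product.mat 1 - M)"
    by (intro continuous_intros)
  then have "closed {M :: 'q qop. predicate M}"
    unfolding eq by (intro closed_Int closed_positive closed_vimage[OF closed_positive])
  moreover have "norm M \<le> rtrace (Finite_Cartesian_Product.mat 1 :: 'q qop)"
    if "predicate M" for M :: "'q qop"
    using that norm_le_rtrace[of M] rtrace_nonneg[of "Finite_Cartesian_Product.mat 1 - M"]
    by (simp add: predicate_iff rtrace_diff)
  then have "bounded {M :: 'q qop. predicate M}"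
    by (auto simp: bounded_iff)
  ultimately show ?thesis by (simp add: compact_eq_bounded_closed)
qed

lemma tendsto_rtrace: "(f \<longlongrightarrow> A) F \<Longrightarrow> ((\<lambda>x. rtrace (f x)) \<longlongrightarrow> rtrace A) F"
  using bounded_linear.tendsto[OF linear_rtrace[unfolded linear_conv_bounded_linear]] .

lemma tendsto_rtrace_mult:
  fixes M :: "('q :: finite) qop"
  shows "(f \<longlongrightarrow> A) F \<Longrightarrow> ((\<lambda>x. rtrace (M ** f x)) \<longlongrightarrow> rtrace (M ** A)) F"
  by (rule tendsto_rtrace[OF bounded_linear.tendsto[OF linear_matrix_mult[unfolded
          linear_conv_bounded_linear]]])

section \<open>Cylindrical extensions\<close>

definition same_outside :: "'q list \<Rightarrow> 'q state \<Rightarrow> 'q state \<Rightarrow> bool" where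
  "same_outside qs s t \<longleftrightarrow> (\<forall>q. q \<notin> set qs \<longrightarrow> s q = t q)"

lemma cyl_component:
  "cyl qs A $ s $ t =
     (if same_outside qs s t then A $$ (basis_index qs s, basis_index qs t) else 0)"
  by (simp add: cyl_def same_outside_def)

lemma basis_index_less: "basis_index qs s < 2 ^ length qs"
  using horner_sum_of_bool_2_less[of "rev (map s qs)"] by (simp add: basis_index_def)

text \<open>The state arises from \<open>s\<close> by updating one register variable at a time;
  distinctness keeps an update from disturbing the other digits.\<close>

lemma ex_state_eq:
  assumes "distinct qs" and "length bs = length qs"
  shows "\<exists>u. map u qs = bs \<and> same_outside qs u s"
  using assms(2,1)
proof (induction bs qs rule: list_induct2)
  case Nil
  then show ?case by (auto simp: same_outside_def)
next
  case (Cons b bs q qs)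
  then obtain u where "map u qs = bs" "same_outside qs u s" by auto
  with Cons.prems show ?case
    by (intro exI[of _ "u(q := b)"]) (auto simp: same_outside_def)
qed

text \<open>With the variables outside the register fixed, a state is determined by its register
  values, the binary digits of the index. This turns sums over global states into sums over matrix
  indices.\<close>

lemma basis_index_bij_betw:
  assumes "distinct qs"
  shows "bij_betw (basis_index qs) {u. same_outside qs u s} {..<2 ^ length qs}"
proof (rule bij_betw_imageI)
  show "inj_on (basis_index qs) {u. same_outside qs u s}"
  proof (rule inj_onI)
    fix u v
    assume *: "u \<in> {u. same_outside qs u s}" "v \<in> {u. same_outside qs u s}"
      and eq: "basis_index qs u = basis_index qs v"
    have "rev (map w qs) ! n = bit (basis_index qs w) n" if "n < length qs" for w n
      using that by (simp add: basis_index_def bit_horner_sum_bit_iff)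
    then have "rev (map u qs) = rev (map v qs)"
      using eq by (intro nth_equalityI) (simp_all del: rev_map)
    then have in_qs: "u q = v q" if "q \<in> set qs" for q
      using that by simp
    show "u = v"
    proof
      fix q
      show "u q = v q"
        using * in_qs[of q] by (cases "q \<in> set qs") (simp_all add: same_outside_def)
    qed
  qed
  have "k \<in> basis_index qs ` {u. same_outside qs u s}" if "k < 2 ^ length qs" for k
  proof -
    \<comment> \<open>The first variable is the most significant digit, so the bits of
      \<open>k\<close> are stored in reverse.\<close>
    obtain u where u: "map u qs = rev (map (bit k) [0..<length qs])" "same_outside qs u s"
      using ex_state_eq[OF assms, of "rev (map (bit k) [0..<length qs])" s] by auto
    have "basis_index qs u = k"
      using that by (simp add: basis_index_def u(1) horner_sum_bit_eq_take_bit take_bit_nat_eq_self)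
    with u(2) show ?thesis by blast
  qed
  then show "basis_index qs ` {u. same_outside qs u s} = {..<2 ^ length qs}"
    by (intro equalityI subsetI) (auto simp: basis_index_less)
qed

text \<open>Only intermediate states that agree with both \<open>s\<close> and \<open>t\<close> off
  the register contribute, and \<open>basis_index\<close> matches them with the inner index of the
  small matrix product. If \<open>s\<close> and \<open>t\<close> disagree there, no such state
  exists.\<close>

lemma cyl_mult:
  assumes "distinct qs"
    and "A \<in> carrier_mat (2 ^ length qs) (2 ^ length qs)"
    and "B \<in> carrier_mat (2 ^ length qs) (2 ^ length qs)"
  shows "cyl qs A ** cyl qs B = cyl qs (A * B)"
proof -
  have "(cyl qs A ** cyl qs B) $ s $ t = cyl qs (A * B) $ s $ t" for s t
  proof (cases "same_outside qs s t")
    case True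
    have "(cyl qs A ** cyl qs B) $ s $ t = (\<Sum>u\<in>UNIV. if same_outside qs u s
        then A $$ (basis_index qs s, basis_index qs u) * B $$ (basis_index qs u, basis_index qs t)
        else 0)"
      unfolding matrix_matrix_mult_def using True
      by (auto intro!: sum.cong simp: cyl_component same_outside_def)
    also have "\<dots> = (\<Sum>u\<in>{u. same_outside qs u s}.
        A $$ (basis_index qs s, basis_index qs u) * B $$ (basis_index qs u, basis_index qs t))"
      by (simp add: sum.If_cases)
    also have "\<dots> = (\<Sum>k<2 ^ length qs. A $$ (basis_index qs s, k) * B $$ (k, basis_index qs t))"
      by (rule sum.reindex_bij_betw[OF basis_index_bij_betw[OF assms(1)]])
    also have "\<dots> = cyl qs (A * B) $ s $ t"
      using assms(2,3) True basis_index_less[of qs]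
      by (simp add: cyl_component scalar_prod_def atLeast0LessThan)
    finally show ?thesis .
  next
    case False
    then have "\<not> (same_outside qs s u \<and> same_outside qs u t)" for u
      by (auto simp: same_outside_def)
    with False show ?thesis
      by (auto simp: matrix_matrix_mult_def cyl_component intro!: sum.neutral)
  qed
  then show ?thesis by (simp add: Finite_Cartesian_Product.vec_eq_iff)
qed

lemma cyl_adjoint:
  assumes "A \<in> carrier_mat (2 ^ length qs) (2 ^ length qs)"
  shows "adj (cyl qs A) = cyl qs (mat_adjoint A)"
proof -
  have "mat_adjoint A $$ (i, j) = cnj (A $$ (j, i))" if "i < 2 ^ length qs" "j < 2 ^ length qs" for i j
    using assms that by (simp add: mat_adjoint_def mat_of_rows_def)
  then show ?thesis
    by (simp add: Finite_Cartesian_Product.vec_eq_iff adj_def map_matrix_def cyl_component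
        Finite_Cartesian_Product.transpose_def basis_index_less) (auto simp: same_outside_def)
qed

lemma cyl_add:
  assumes "B \<in> carrier_mat (2 ^ length qs) (2 ^ length qs)"
  shows "cyl qs (A + B) = cyl qs A + cyl qs B"
  using assms by (simp add: Finite_Cartesian_Product.vec_eq_iff cyl_component basis_index_less)

lemma cyl_one:
  assumes "distinct qs"
  shows "cyl qs (1\<^sub>m (2 ^ length qs)) = Finite_Cartesian_Product.mat 1"
proof -
  have "basis_index qs s = basis_index qs t \<longleftrightarrow> s = t" if "same_outside qs s t" for s t
    using inj_onD[OF bij_betw_imp_inj_on[OF basis_index_bij_betw[OF assms, of t]], of s t] that
    by (auto simp: same_outside_def)
  then show ?thesis
    by (auto simp: Finite_Cartesian_Product.vec_eq_iff cyl_component basis_index_less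
        Finite_Cartesian_Product.mat_def same_outside_def)
qed

section \<open>Matrix units on a register\<close>

lemma adj_ketbra: "adj (ketbra qs i j) = ketbra qs j i"
  by (auto simp: Finite_Cartesian_Product.vec_eq_iff ketbra_def adj_def map_matrix_def
      cyl_component Finite_Cartesian_Product.transpose_def basis_index_less same_outside_def)

lemma ketbra_mult:
  assumes "distinct qs" and "j < 2 ^ length qs"
  shows "ketbra qs i j ** ketbra qs j k = ketbra qs i k"
proof -
  let ?n = "2 ^ length qs"
  let ?E = "\<lambda>i j. Matrix.mat ?n ?n (\<lambda>(k, l). of_bool (k = i \<and> l = j)) :: complex Matrix.mat"
  have "?E i j * ?E j k = ?E i k"
  proof (rule eq_matI)
    fix r c
    assume *: "r < dim_row (?E i k)" "c < dim_col (?E i k)"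
    then have "(?E i j * ?E j k) $$ (r, c) =
        (\<Sum>l\<in>{0..<?n}. if l = j then of_bool (r = i \<and> c = k) else 0)"
      by (simp add: scalar_prod_def) (auto intro!: sum.cong)
    with * assms(2) show "(?E i j * ?E j k) $$ (r, c) = ?E i k $$ (r, c)"
      by simp
  qed simp_all
  then show ?thesis
    by (simp add: ketbra_def cyl_mult[OF assms(1)])
qed

lemma sum_ketbra:
  assumes "distinct qs"
  shows "(\<Sum>i<2 ^ length qs. ketbra qs i i) = Finite_Cartesian_Product.mat 1"
proof -
  have "(\<Sum>i<2 ^ length qs. ketbra qs i i) $ s $ t = cyl qs (1\<^sub>m (2 ^ length qs)) $ s $ t" for s t
  proof -
    have "(\<Sum>i<2 ^ length qs. ketbra qs i i) $ s $ t = (\<Sum>i<2 ^ length qs.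
        if i = basis_index qs s then of_bool (same_outside qs s t \<and> i = basis_index qs t) else 0)"
      by (auto intro!: sum.cong simp: ketbra_def cyl_component basis_index_less)
    also have "\<dots> = cyl qs (1\<^sub>m (2 ^ length qs)) $ s $ t"
      by (simp add: cyl_component basis_index_less)
    finally show ?thesis .
  qed
  then show ?thesis
    by (simp add: cyl_one[OF assms] Finite_Cartesian_Product.vec_eq_iff)
qed

section \<open>Quantum operations and weakest liberal preconditions\<close>

text \<open>For a super-operator with adjoint E*, the operator E*(M) + I - E*(I) is such an
  \<open>N\<close>; the trace identity avoids mentioning E*.\<close>

definition is_wlp :: "('q :: finite) superop \<Rightarrow> 'q qop \<Rightarrow> 'q qop \<Rightarrow> bool" where
  "is_wlp \<E> M N \<longleftrightarrow>
     (\<forall>\<rho>. positive \<rho> \<longrightarrow> rtrace (N ** \<rho>) = rtrace (M ** \<E> \<rho>) + rtrace \<rho> - rtrace (\<E> \<rho>))"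

text \<open>
  Only the action on positive operators matters.  Existence of weakest liberal preconditions
  replaces linearity and the adjoint super-operator.
\<close>

definition quantum_op :: "('q :: finite) superop \<Rightarrow> bool" where
  "quantum_op \<E> \<longleftrightarrow>
     (\<forall>\<rho>. positive \<rho> \<longrightarrow> positive (\<E> \<rho>) \<and> rtrace (\<E> \<rho>) \<le> rtrace \<rho>) \<and>
     (\<forall>M. predicate M \<longrightarrow> (\<exists>N. predicate N \<and> is_wlp \<E> M N))"

lemma quantum_opD:
  assumes "quantum_op \<E>" and "positive \<rho>"
  shows "positive (\<E> \<rho>)" and "rtrace (\<E> \<rho>) \<le> rtrace \<rho>"
  using assms by (auto simp: quantum_op_def)

lemma quantum_op_wlpE:
  assumes "quantum_op \<E>" and "predicate M"
  obtains N where "predicate N" and "is_wlp \<E> M N"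
  using assms by (auto simp: quantum_op_def)

lemma is_wlpD:
  "is_wlp \<E> M N \<Longrightarrow> positive \<rho> \<Longrightarrow>
     rtrace (N ** \<rho>) = rtrace (M ** \<E> \<rho>) + rtrace \<rho> - rtrace (\<E> \<rho>)"
  by (simp add: is_wlp_def)

lemma is_wlp_id: "is_wlp id M M"
  by (simp add: is_wlp_def)

lemma is_wlp_zero: "is_wlp (\<lambda>\<rho>. 0) M (Finite_Cartesian_Product.mat 1)"
  by (simp add: is_wlp_def)

text \<open>Trace losses telescope: the loss of \<open>\<E>\<close> plus the loss of
  \<open>\<F>\<close> on its output is the loss of the composition.\<close>

lemma is_wlp_comp:
  assumes "quantum_op \<E>" and "is_wlp \<F> M N" and "is_wlp \<E> N K"
  shows "is_wlp (\<F> \<circ> \<E>) M K"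
  using assms by (simp add: is_wlp_def quantum_op_def)

lemma quantum_op_id: "quantum_op id"
  using is_wlp_id by (auto simp: quantum_op_def)

lemma quantum_op_zero: "quantum_op (\<lambda>\<rho>. 0)"
  using is_wlp_zero predicate_one by (auto simp: quantum_op_def positive_0 rtrace_nonneg)

lemma quantum_op_comp:
  assumes "quantum_op \<E>" and "quantum_op \<F>"
  shows "quantum_op (\<F> \<circ> \<E>)"
  unfolding quantum_op_def
proof (intro conjI allI impI)
  fix \<rho> assume "positive (\<rho> :: 'a qop)"
  note * = quantum_opD[OF assms(1) this]
  note ** = quantum_opD[OF assms(2) *(1)]
  from ** show "positive ((\<F> \<circ> \<E>) \<rho>)" by simp
  from *(2) **(2) show "rtrace ((\<F> \<circ> \<E>) \<rho>) \<le> rtrace \<rho>" by simp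
next
  fix M assume "predicate (M :: 'a qop)"
  then obtain N where "predicate N" "is_wlp \<F> M N"
    by (rule quantum_op_wlpE[OF assms(2)])
  moreover from \<open>predicate N\<close> obtain K where "predicate K" "is_wlp \<E> N K"
    by (rule quantum_op_wlpE[OF assms(1)])
  ultimately show "\<exists>N. predicate N \<and> is_wlp (\<F> \<circ> \<E>) M N"
    using is_wlp_comp[OF assms(1)] by blast
qed

lemma rtrace_conj: "rtrace (M ** (K ** \<rho> ** L)) = rtrace ((L ** M ** K) ** \<rho>)"
  using rtrace_mult_commute[of "M ** K ** \<rho>" L] by (simp add: matrix_mul_assoc)

text \<open>By cyclicity of the trace, \<open>dual\<close> is the adjoint of \<open>\<E>\<close>.
  The completeness relation makes \<open>dual\<close> unital, so \<open>\<E>\<close> preserves the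
  trace, the correction term vanishes and \<open>dual M\<close> itself is the weakest liberal
  precondition.\<close>

lemma
  fixes K :: "'i \<Rightarrow> ('q :: finite) qop" and I :: "'i set"
  defines "\<E> \<equiv> (\<lambda>\<rho>. \<Sum>i\<in>I. K i ** \<rho> ** adj (K i))"
    and "dual \<equiv> (\<lambda>M. \<Sum>i\<in>I. adj (K i) ** M ** K i)"
  assumes sum: "(\<Sum>i\<in>I. adj (K i) ** K i) = Finite_Cartesian_Product.mat 1"
  shows kraus_quantum_op: "quantum_op \<E>"
    and kraus_predicate: "predicate M \<Longrightarrow> predicate (dual M)"
    and kraus_is_wlp: "is_wlp \<E> M (dual M)"
proof -
  have dual: "rtrace (dual M ** \<rho>) = rtrace (M ** \<E> \<rho>)" for M \<rho>
    by (simp add: dual_def \<E>_def matrix_sum_ldistrib matrix_sum_rdistrib rtrace_sum rtrace_conj)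
  have dual_one: "dual (Finite_Cartesian_Product.mat 1) = Finite_Cartesian_Product.mat 1"
    using sum by (simp add: dual_def)
  have trace: "rtrace (\<E> \<rho>) = rtrace \<rho>" for \<rho>
    using dual[of "Finite_Cartesian_Product.mat 1" \<rho>] by (simp add: dual_one)
  have pos: "positive (\<E> \<rho>)" if "positive \<rho>" for \<rho>
    unfolding \<E>_def using that by (intro positive_sum positive_conj)
  have dual_pos: "positive (dual M)" if "positive M" for M
    unfolding dual_def using positive_conj[OF that, of "adj _"] by (intro positive_sum) simp
  \<comment> \<open>A unital \<open>dual\<close> commutes with complements, so the upper bound of a
    predicate reduces to positivity.\<close>
  have "dual (Finite_Cartesian_Product.mat 1 - M) = Finite_Cartesian_Product.mat 1 - dual M" for M
    by (subst (2) dual_one[symmetric])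
      (simp add: dual_def matrix_diff_ldistrib matrix_diff_rdistrib sum_subtractf)
  then show pred: "predicate (dual M)" if "predicate M" for M
    using that dual_pos[of M] dual_pos[of "Finite_Cartesian_Product.mat 1 - M"]
    by (simp add: predicate_iff)
  show wlp: "is_wlp \<E> M (dual M)" for M
    by (simp add: is_wlp_def dual trace)
  show "quantum_op \<E>"
    unfolding quantum_op_def using pos pred wlp by (auto simp: trace)
qed

text \<open>The sum over the one-point set \<open>{()}\<close> makes a unitary an instance of the
  Kraus lemma.\<close>

lemma unitary_kraus:
  assumes "distinct qs" and "is_unitary (2 ^ length qs) U"
  shows "(\<Sum>i\<in>{()}. adj (cyl qs U) ** cyl qs U) = Finite_Cartesian_Product.mat 1"
proof -
  have U: "U \<in> carrier_mat (2 ^ length qs) (2 ^ length qs)"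
    "mat_adjoint U * U = 1\<^sub>m (2 ^ length qs)"
    using assms(2) by (auto simp: is_unitary_def)
  then have "mat_adjoint U \<in> carrier_mat (2 ^ length qs) (2 ^ length qs)"
    by (auto simp: mat_adjoint_def)
  with U show ?thesis
    by (simp add: cyl_adjoint cyl_mult[OF assms(1)] cyl_one[OF assms(1)])
qed

lemma set0_kraus:
  assumes "distinct qs"
  shows "(\<Sum>i<2 ^ length qs. adj (ketbra qs 0 i) ** ketbra qs 0 i) = Finite_Cartesian_Product.mat 1"
  using assms by (simp add: adj_ketbra ketbra_mult sum_ketbra)

lemma set0_op_kraus: "set0_op qs = (\<lambda>\<rho>. \<Sum>i<2 ^ length qs. ketbra qs 0 i ** \<rho> ** adj (ketbra qs 0 i))"
  by (simp add: set0_op_def adj_ketbra)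

lemma unitary_op_kraus: "unitary_op qs U = (\<lambda>\<rho>. \<Sum>i\<in>{()}. cyl qs U ** \<rho> ** adj (cyl qs U))"
  by (simp add: unitary_op_def)

section \<open>Measurements and loops\<close>

lemma rtrace_proj_op: "rtrace (proj_op qs P M ** \<rho>) = rtrace (M ** proj_op qs P \<rho>)"
  by (simp add: proj_op_def rtrace_conj)

text \<open>\<open>sched_iter\<close> appends rounds at the end. Unfolding a loop instead splits off
  the first round and runs the rest under the shifted scheduler.\<close>

lemma sched_iter_shift:
  "sched_iter \<P> \<eta> (Suc i) \<rho> = sched_iter \<P> (\<lambda>k. \<eta> (Suc k)) i (\<eta> 0 (\<P> \<rho>))"
  by (induction i) simp_all

locale projective_measurement =
  fixes qs :: "('q :: finite) list" and P0 P1 :: "complex Matrix.mat"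
  assumes distinct: "distinct qs"
    and measurement: "is_projective_measurement (2 ^ length qs) P0 P1"
begin

lemma cyl_projector:
  assumes "P \<in> {P0, P1}"
  shows "adj (cyl qs P) = cyl qs P" and "cyl qs P ** cyl qs P = cyl qs P"
  using assms measurement
  by (auto simp: is_projective_measurement_def is_projector_def cyl_adjoint cyl_mult[OF distinct])

lemma cyl_complete: "cyl qs P0 + cyl qs P1 = Finite_Cartesian_Product.mat 1"
  using measurement cyl_add[of P1 qs P0] cyl_one[OF distinct]
  by (simp add: is_projective_measurement_def is_projector_def)

lemma positive_proj_op: "P \<in> {P0, P1} \<Longrightarrow> positive \<rho> \<Longrightarrow> positive (proj_op qs P \<rho>)"
  using positive_conj[of \<rho> "cyl qs P"] by (simp add: proj_op_def cyl_projector)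

lemma proj_op_complete:
  "proj_op qs P0 (Finite_Cartesian_Product.mat 1) + proj_op qs P1 (Finite_Cartesian_Product.mat 1)
     = Finite_Cartesian_Product.mat 1"
  by (simp add: proj_op_def cyl_projector cyl_complete)

text \<open>Moved to the side of predicates, this is \<open>proj_op_complete\<close>. It lets the
  trace losses of the two branches of a measurement be added up.\<close>

lemma rtrace_proj_op_sum: "rtrace (proj_op qs P0 \<rho>) + rtrace (proj_op qs P1 \<rho>) = rtrace \<rho>"
proof -
  have "rtrace (proj_op qs P0 \<rho>) + rtrace (proj_op qs P1 \<rho>) =
      rtrace ((proj_op qs P0 (Finite_Cartesian_Product.mat 1)
        + proj_op qs P1 (Finite_Cartesian_Product.mat 1)) ** \<rho>)"
    by (simp add: matrix_add_rdistrib rtrace_add rtrace_proj_op)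
  then show ?thesis by (simp add: proj_op_complete)
qed

lemma predicate_meas:
  assumes "predicate M" and "predicate N"
  shows "predicate (proj_op qs P0 M + proj_op qs P1 N)"
proof -
  \<comment> \<open>The complement has the same shape, built from the complements of
    \<open>M\<close> and \<open>N\<close>.\<close>
  have "Finite_Cartesian_Product.mat 1 - (proj_op qs P0 M + proj_op qs P1 N) =
      proj_op qs P0 (Finite_Cartesian_Product.mat 1 - M)
      + proj_op qs P1 (Finite_Cartesian_Product.mat 1 - N)"
    by (subst proj_op_complete[symmetric])
      (simp add: proj_op_def matrix_diff_ldistrib matrix_diff_rdistrib)
  with assms show ?thesis
    by (auto simp: predicate_iff intro!: positive_add positive_proj_op)
qed

lemma density_proj_op:
  assumes "P \<in> {P0, P1}" and "density \<rho>"
  shows "density (proj_op qs P \<rho>)"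
proof -
  have "positive \<rho>" using assms by (simp add: density_def)
  then have "0 \<le> rtrace (proj_op qs P0 \<rho>)" "0 \<le> rtrace (proj_op qs P1 \<rho>)"
    by (auto intro!: rtrace_nonneg positive_proj_op)
  with assms rtrace_proj_op_sum[of \<rho>] show ?thesis
    by (auto simp: density_def positive_proj_op)
qed

text \<open>The trace of \<open>M\<close> on the combined output splits into the two branches, and
  so does the trace loss. This is where both branches refer to one common \<open>M\<close>.\<close>

lemma is_wlp_cond:
  assumes "is_wlp \<E> M N0" and "is_wlp \<F> M N1"
  shows "is_wlp (\<lambda>\<rho>. \<E> (proj_op qs P0 \<rho>) + \<F> (proj_op qs P1 \<rho>)) M
    (proj_op qs P0 N0 + proj_op qs P1 N1)"
  unfolding is_wlp_def
proof (intro allI impI)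
  fix \<rho> assume "positive (\<rho> :: 'q qop)"
  then show "rtrace ((proj_op qs P0 N0 + proj_op qs P1 N1) ** \<rho>) =
      rtrace (M ** (\<E> (proj_op qs P0 \<rho>) + \<F> (proj_op qs P1 \<rho>))) + rtrace \<rho>
      - rtrace (\<E> (proj_op qs P0 \<rho>) + \<F> (proj_op qs P1 \<rho>))"
    using rtrace_proj_op_sum[of \<rho>] is_wlpD[OF assms(1), of "proj_op qs P0 \<rho>"]
      is_wlpD[OF assms(2), of "proj_op qs P1 \<rho>"]
    by (simp add: positive_proj_op matrix_add_rdistrib matrix_add_ldistrib rtrace_add rtrace_proj_op)
qed

lemma quantum_op_cond:
  assumes "quantum_op \<E>" and "quantum_op \<F>"
  shows "quantum_op (\<lambda>\<rho>. \<E> (proj_op qs P0 \<rho>) + \<F> (proj_op qs P1 \<rho>))"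
  unfolding quantum_op_def
proof (intro conjI allI impI)
  fix \<rho> assume "positive (\<rho> :: 'q qop)"
  then have "positive (proj_op qs P0 \<rho>)" "positive (proj_op qs P1 \<rho>)"
    by (simp_all add: positive_proj_op)
  note * = quantum_opD[OF assms(1) this(1)] quantum_opD[OF assms(2) this(2)]
  from * show "positive (\<E> (proj_op qs P0 \<rho>) + \<F> (proj_op qs P1 \<rho>))"
    by (simp add: positive_add)
  from * show "rtrace (\<E> (proj_op qs P0 \<rho>) + \<F> (proj_op qs P1 \<rho>)) \<le> rtrace \<rho>"
    using rtrace_proj_op_sum[of \<rho>] by (simp add: rtrace_add)
next
  fix M assume M: "predicate (M :: 'q qop)"
  obtain N0 where "predicate N0" "is_wlp \<E> M N0"
    using M by (rule quantum_op_wlpE[OF assms(1)])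
  moreover obtain N1 where "predicate N1" "is_wlp \<F> M N1"
    using M by (rule quantum_op_wlpE[OF assms(2)])
  ultimately show "\<exists>N. predicate N \<and>
      is_wlp (\<lambda>\<rho>. \<E> (proj_op qs P0 \<rho>) + \<F> (proj_op qs P1 \<rho>)) M N"
    using is_wlp_cond predicate_meas by blast
qed

section \<open>Loops as series over a scheduler\<close>

definition while_term :: "(nat \<Rightarrow> 'q superop) \<Rightarrow> nat \<Rightarrow> 'q superop" where
  "while_term \<eta> i \<rho> = proj_op qs P0 (sched_iter (proj_op qs P1) \<eta> i \<rho>)"

definition while_op :: "(nat \<Rightarrow> 'q superop) \<Rightarrow> 'q superop" where
  "while_op \<eta> \<rho> = (\<Sum>i. while_term \<eta> i \<rho>)"

lemma while_term_0: "while_term \<eta> 0 \<rho> = proj_op qs P0 \<rho>"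
  by (simp add: while_term_def)

lemma while_term_Suc:
  "while_term \<eta> (Suc i) \<rho> = while_term (\<lambda>k. \<eta> (Suc k)) i (\<eta> 0 (proj_op qs P1 \<rho>))"
  by (simp only: while_term_def sched_iter_shift)

context
  fixes \<eta> :: "nat \<Rightarrow> 'q superop"
  assumes \<eta>: "\<And>k. quantum_op (\<eta> k)"
begin

lemma positive_sched_iter: "positive \<rho> \<Longrightarrow> positive (sched_iter (proj_op qs P1) \<eta> i \<rho>)"
  by (induction i) (auto intro!: quantum_opD(1)[OF \<eta>] positive_proj_op)

lemma positive_while_term: "positive \<rho> \<Longrightarrow> positive (while_term \<eta> i \<rho>)"
  by (simp add: while_term_def positive_proj_op positive_sched_iter)

lemma rtrace_while_partial:
  assumes "positive \<rho>"
  shows "(\<Sum>i<n. rtrace (while_term \<eta> i \<rho>)) \<le> rtrace \<rho>"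
proof -
  \<comment> \<open>The trace still inside the loop is included in the bound; a further round splits
    it into an exit term and a part that the body cannot enlarge.\<close>
  have "(\<Sum>i<n. rtrace (while_term \<eta> i \<rho>)) + rtrace (sched_iter (proj_op qs P1) \<eta> n \<rho>) \<le> rtrace \<rho>"
  proof (induction n)
    case (Suc n)
    let ?\<sigma> = "sched_iter (proj_op qs P1) \<eta> n \<rho>"
    have "rtrace (\<eta> n (proj_op qs P1 ?\<sigma>)) \<le> rtrace (proj_op qs P1 ?\<sigma>)"
      by (intro quantum_opD(2)[OF \<eta>] positive_proj_op positive_sched_iter assms) simp
    with Suc rtrace_proj_op_sum[of ?\<sigma>] show ?case
      by (simp add: while_term_def)
  qed simp
  with rtrace_nonneg[OF positive_sched_iter[OF assms, of n]] show ?thesis by simp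
qed

text \<open>The terms are positive, so their norms are dominated by their traces, whose partial sums
  are bounded.\<close>

lemma summable_while_term:
  assumes "positive \<rho>"
  shows "summable (\<lambda>i. while_term \<eta> i \<rho>)"
proof (rule summable_comparison_test')
  show "summable (\<lambda>i. rtrace (while_term \<eta> i \<rho>))"
    using rtrace_while_partial[OF assms] positive_while_term[OF assms]
    by (intro summableI_nonneg_bounded[of _ "rtrace \<rho>"]) (auto intro: rtrace_nonneg)
  show "norm (while_term \<eta> i \<rho>) \<le> rtrace (while_term \<eta> i \<rho>)" if "0 \<le> i" for i
    by (intro norm_le_rtrace positive_while_term assms)
qed

lemma while_op_LIMSEQ:
  "positive \<rho> \<Longrightarrow> (\<lambda>n. \<Sum>i<n. while_term \<eta> i \<rho>) \<longlonglongrightarrow> while_op \<eta> \<rho>"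
  unfolding while_op_def by (intro summable_LIMSEQ summable_while_term)

lemma positive_while_op: "positive \<rho> \<Longrightarrow> positive (while_op \<eta> \<rho>)"
  using closed_sequentially[OF closed_positive, of "\<lambda>n. \<Sum>i<n. while_term \<eta> i \<rho>" "while_op \<eta> \<rho>"]
  by (simp add: while_op_LIMSEQ positive_sum positive_while_term)

lemma rtrace_while_op_le:
  assumes "positive \<rho>"
  shows "rtrace (while_op \<eta> \<rho>) \<le> rtrace \<rho>"
  using rtrace_while_partial[OF assms]
  by (intro LIMSEQ_le_const2[OF tendsto_rtrace[OF while_op_LIMSEQ[OF assms]]])
    (simp add: rtrace_sum)

end

text \<open>The loop as a conditional with exit branch \<open>id\<close>. In the completeness proof
  it shows that one body run in front of a loop amounts to a loop under an extended
  scheduler.\<close>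

lemma while_op_unfold:
  assumes \<eta>: "\<And>k. quantum_op (\<eta> k)" and "positive \<rho>"
  shows "while_op \<eta> \<rho> = proj_op qs P0 \<rho> + while_op (\<lambda>k. \<eta> (Suc k)) (\<eta> 0 (proj_op qs P1 \<rho>))"
  using suminf_split_head[OF summable_while_term[of \<eta> \<rho>]] assms
  by (simp add: while_op_def while_term_Suc while_term_0 algebra_simps)

text \<open>A partial sum with one more term is a conditional: exit at once, or run one body and
  then the shorter sum under the shifted scheduler. The empty sum is the zero map, with precondition
  the identity.\<close>

lemma while_partial_is_wlp:
  assumes "\<And>k. quantum_op (\<eta> k)" and M: "predicate M"
  shows "\<exists>N. predicate N \<and> is_wlp (\<lambda>\<rho>. \<Sum>i<n. while_term \<eta> i \<rho>) M N"
  using assms(1)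
proof (induction n arbitrary: \<eta>)
  case 0
  show ?case using predicate_one is_wlp_zero by auto
next
  case (Suc n)
  let ?\<F> = "\<lambda>\<rho>. \<Sum>i<n. while_term (\<lambda>k. \<eta> (Suc k)) i \<rho>"
  obtain N where N: "predicate N" "is_wlp ?\<F> M N"
    using Suc.IH[of "\<lambda>k. \<eta> (Suc k)"] Suc.prems by auto
  obtain K where "predicate K" and K: "is_wlp (\<eta> 0) N K"
    using N(1) by (rule quantum_op_wlpE[OF Suc.prems])
  have "is_wlp (\<lambda>\<rho>. id (proj_op qs P0 \<rho>) + (?\<F> \<circ> \<eta> 0) (proj_op qs P1 \<rho>)) M
      (proj_op qs P0 M + proj_op qs P1 K)"
    by (intro is_wlp_cond is_wlp_id is_wlp_comp[OF Suc.prems N(2) K])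
  then have "is_wlp (\<lambda>\<rho>. \<Sum>i<Suc n. while_term \<eta> i \<rho>) M (proj_op qs P0 M + proj_op qs P1 K)"
    by (simp add: sum.lessThan_Suc_shift while_term_0 while_term_Suc del: sum.lessThan_Suc)
  with predicate_meas[OF M \<open>predicate K\<close>] show ?case by blast
qed

text \<open>
  The weakest liberal precondition of a loop is an accumulation point of those of its finite
  unfoldings.
\<close>

lemma quantum_op_while_op:
  assumes \<eta>: "\<And>k. quantum_op (\<eta> k)"
  shows "quantum_op (while_op \<eta>)"
  unfolding quantum_op_def
proof (intro conjI allI impI)
  fix \<rho> assume "positive (\<rho> :: 'q qop)"
  then show "positive (while_op \<eta> \<rho>)" "rtrace (while_op \<eta> \<rho>) \<le> rtrace \<rho>"
    using \<eta> by (simp_all add: positive_while_op rtrace_while_op_le)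
next
  fix M assume M: "predicate (M :: 'q qop)"
  have "\<forall>n. \<exists>N. predicate N \<and> is_wlp (\<lambda>\<rho>. \<Sum>i<n. while_term \<eta> i \<rho>) M N"
    by (intro allI while_partial_is_wlp \<eta> M)
  from choice[OF this] obtain N where N: "\<And>n. predicate (N n)"
    "\<And>n. is_wlp (\<lambda>\<rho>. \<Sum>i<n. while_term \<eta> i \<rho>) M (N n)"
    by auto
  obtain L r where L: "predicate L" and r: "strict_mono r" "(N \<circ> r) \<longlonglongrightarrow> L"
    using seq_compactE[OF compact_imp_seq_compact[OF compact_predicate], of N] N(1) by auto
  have "rtrace (L ** \<rho>) = rtrace (M ** while_op \<eta> \<rho>) + rtrace \<rho> - rtrace (while_op \<eta> \<rho>)"
    if "positive \<rho>" for \<rho>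
  \<comment> \<open>Both sides are limits of the same traces along the subsequence
    \<open>r\<close>.\<close>
  proof (rule LIMSEQ_unique)
    show "(\<lambda>n. rtrace (N (r n) ** \<rho>)) \<longlonglongrightarrow> rtrace (L ** \<rho>)"
      using tendsto_rtrace_mult[OF r(2), of \<rho>]
      by (simp add: rtrace_mult_commute[of \<rho>] o_def)
    have "(\<lambda>n. \<Sum>i<r n. while_term \<eta> i \<rho>) \<longlonglongrightarrow> while_op \<eta> \<rho>"
      using LIMSEQ_subseq_LIMSEQ[OF while_op_LIMSEQ[of \<eta>, OF \<eta> that] r(1)] by (simp add: o_def)
    then show "(\<lambda>n. rtrace (N (r n) ** \<rho>)) \<longlonglongrightarrow>
        rtrace (M ** while_op \<eta> \<rho>) + rtrace \<rho> - rtrace (while_op \<eta> \<rho>)"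
      unfolding is_wlpD[OF N(2) that]
      by (intro tendsto_intros tendsto_rtrace_mult tendsto_rtrace)
  qed
  with L show "\<exists>N. predicate N \<and> is_wlp (while_op \<eta>) M N"
    by (auto simp: is_wlp_def)
qed

end

lemma sem_While:
  assumes "projective_measurement qs P0 P1"
  shows "sem (While P0 P1 qs S) =
    {projective_measurement.while_op qs P0 P1 \<eta> |\<eta>. \<forall>k. \<eta> k \<in> sem S}"
  by (simp add: fun_eq_iff projective_measurement.while_op_def[OF assms]
      projective_measurement.while_term_def[OF assms])

lemma sem_quantum_op: "wf_prog S \<Longrightarrow> \<E> \<in> sem S \<Longrightarrow> quantum_op \<E>"
proof (induction S arbitrary: \<E>)
  case (Init qs)
  then show ?case
    using kraus_quantum_op[OF set0_kraus] by (simp add: set0_op_kraus)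
next
  case (Unitary qs U)
  then show ?case
    using kraus_quantum_op[OF unitary_kraus[of qs U]] by (simp add: unitary_op_kraus)
next
  case (Cond P0 P1 qs S1 S0)
  then interpret projective_measurement qs P0 P1
    by unfold_locales simp_all
  from Cond show ?case by (auto intro!: quantum_op_cond)
next
  case (While P0 P1 qs S)
  then interpret projective_measurement qs P0 P1
    by unfold_locales simp_all
  from While show ?case
    by (auto simp: sem_While[OF projective_measurement_axioms] simp del: sem.simps
        intro!: quantum_op_while_op)
qed (auto simp: quantum_op_id quantum_op_zero quantum_op_comp)

text \<open>A constant scheduler settles the loop case. The fact is for the nonemptiness condition
  of rule \<open>While\<close>.\<close>

lemma sem_nonempty: "sem S \<noteq> {}"
proof (induction S)
  case (While P0 P1 qs S)
  then obtain \<E> where "\<E> \<in> sem S" by blast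
  then have "\<exists>\<eta>. \<forall>k :: nat. \<eta> k \<in> sem S" by (intro exI[of _ "\<lambda>_. \<E>"]) simp
  then show ?case by simp
qed auto

section \<open>Soundness\<close>

text \<open>The infimum need not be attained, hence the margin \<open>\<epsilon>\<close>. For an
  empty \<open>\<Theta>\<close> it is \<infinity>, and both sides are false.\<close>

lemma Exp_le_iff:
  "Exp \<rho> \<Theta> \<le> ereal c \<longleftrightarrow> (\<forall>\<epsilon>>0. \<exists>M\<in>\<Theta>. rtrace (M ** \<rho>) < c + \<epsilon>)"
proof
  assume le: "Exp \<rho> \<Theta> \<le> ereal c"
  show "\<forall>\<epsilon>>0. \<exists>M\<in>\<Theta>. rtrace (M ** \<rho>) < c + \<epsilon>"
  proof (intro allI impI)
    fix \<epsilon> :: real assume "\<epsilon> > 0"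
    then have "Exp \<rho> \<Theta> < ereal (c + \<epsilon>)"
      by (intro le_less_trans[OF le]) simp
    then show "\<exists>M\<in>\<Theta>. rtrace (M ** \<rho>) < c + \<epsilon>"
      by (simp add: Exp_def INF_less_iff)
  qed
next
  assume *: "\<forall>\<epsilon>>0. \<exists>M\<in>\<Theta>. rtrace (M ** \<rho>) < c + \<epsilon>"
  show "Exp \<rho> \<Theta> \<le> ereal c"
  proof (rule ereal_le_epsilon2)
    fix \<epsilon> :: real assume "\<epsilon> > 0"
    with * obtain M where "M \<in> \<Theta>" "rtrace (M ** \<rho>) < c + \<epsilon>" by blast
    then show "Exp \<rho> \<Theta> \<le> ereal c + ereal \<epsilon>"
      unfolding Exp_def by (intro INF_lower2[of M]) auto
  qed
qed

lemma le_inf_iff: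
  "\<Theta> \<le>\<^sub>i\<^sub>n\<^sub>f \<Psi> \<longleftrightarrow> (\<forall>\<rho>. density \<rho> \<longrightarrow>
     (\<forall>N\<in>\<Psi>. \<forall>\<epsilon>>0. \<exists>M\<in>\<Theta>. rtrace (M ** \<rho>) < rtrace (N ** \<rho>) + \<epsilon>))"
  unfolding le_inf_def Exp_def[of _ \<Psi>] le_INF_iff Exp_le_iff ..

text \<open>A finite shift can be moved across the inequality, after which a lower bound of an
  infimum is checked elementwise. An empty \<open>\<Psi>\<close> makes both sides true.\<close>

lemma le_Exp_shift_iff:
  "x \<le> Exp \<sigma> \<Psi> + ereal a - ereal b \<longleftrightarrow> (\<forall>N\<in>\<Psi>. x \<le> ereal (rtrace (N ** \<sigma>) + a - b))"
proof -
  have shift: "x \<le> y + ereal a - ereal b \<longleftrightarrow> x - ereal (a - b) \<le> y" for y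
    by (cases x; cases y) auto
  show ?thesis
    unfolding shift Exp_def le_INF_iff by (cases x) auto
qed

lemma valid_par_iff_le:
  "valid_par \<Theta> S \<Psi> \<longleftrightarrow> (\<forall>\<rho>. density \<rho> \<longrightarrow> (\<forall>\<E>\<in>sem S. \<forall>N\<in>\<Psi>.
     Exp \<rho> \<Theta> \<le> ereal (rtrace (N ** \<E> \<rho>) + rtrace \<rho> - rtrace (\<E> \<rho>))))"
  unfolding valid_par_def le_INF_iff le_Exp_shift_iff by auto

lemma valid_par_iff:
  "valid_par \<Theta> S \<Psi> \<longleftrightarrow> (\<forall>\<rho>. density \<rho> \<longrightarrow> (\<forall>\<E>\<in>sem S. \<forall>N\<in>\<Psi>. \<forall>\<epsilon>>0. \<exists>M\<in>\<Theta>.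
     rtrace (M ** \<rho>) < rtrace (N ** \<E> \<rho>) + rtrace \<rho> - rtrace (\<E> \<rho>) + \<epsilon>))"
  unfolding valid_par_iff_le Exp_le_iff ..

section \<open>Validity of the axioms and rules\<close>

lemma valid_parI:
  assumes "\<And>\<rho> \<E> N \<epsilon>. density \<rho> \<Longrightarrow> \<E> \<in> sem S \<Longrightarrow> N \<in> \<Psi> \<Longrightarrow> \<epsilon> > 0 \<Longrightarrow>
    \<exists>M\<in>\<Theta>. rtrace (M ** \<rho>) < rtrace (N ** \<E> \<rho>) + rtrace \<rho> - rtrace (\<E> \<rho>) + \<epsilon>"
  shows "valid_par \<Theta> S \<Psi>"
  using assms by (simp add: valid_par_iff)

lemma valid_parE:
  assumes "valid_par \<Theta> S \<Psi>" and "density \<rho>" "\<E> \<in> sem S" "N \<in> \<Psi>" "\<epsilon> > 0"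
  obtains M where "M \<in> \<Theta>"
    and "rtrace (M ** \<rho>) < rtrace (N ** \<E> \<rho>) + rtrace \<rho> - rtrace (\<E> \<rho>) + \<epsilon>"
  using assms(1)[unfolded valid_par_iff, rule_format, OF assms(2-5)] that by blast

lemma le_infE:
  assumes "\<Theta> \<le>\<^sub>i\<^sub>n\<^sub>f \<Psi>" and "density \<rho>" "N \<in> \<Psi>" "\<epsilon> > 0"
  obtains M where "M \<in> \<Theta>" and "rtrace (M ** \<rho>) < rtrace (N ** \<rho>) + \<epsilon>"
  using assms(1)[unfolded le_inf_iff, rule_format, OF assms(2-4)] that by blast

lemma density_quantum_op: "quantum_op \<E> \<Longrightarrow> density \<rho> \<Longrightarrow> density (\<E> \<rho>)"
  using quantum_opD[of \<E> \<rho>] by (auto simp: density_def)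

lemma density_sem: "wf_prog S \<Longrightarrow> \<E> \<in> sem S \<Longrightarrow> density \<rho> \<Longrightarrow> density (\<E> \<rho>)"
  by (rule density_quantum_op[OF sem_quantum_op])

text \<open>With a single super-operator, \<open>f N\<close> is the witness and its trace equals the
  bound before \<open>\<epsilon>\<close> is added. This covers all four axioms.\<close>

lemma valid_par_image_wlp:
  assumes "sem S = {\<E>}" and "\<And>M. M \<in> \<Psi> \<Longrightarrow> is_wlp \<E> M (f M)"
  shows "valid_par (f ` \<Psi>) S \<Psi>"
proof (rule valid_parI)
  fix \<rho> :: "'a qop" and \<F> N and \<epsilon> :: real
  assume "density \<rho>" "\<F> \<in> sem S" "N \<in> \<Psi>" "\<epsilon> > 0"
  then show "\<exists>M\<in>f ` \<Psi>. rtrace (M ** \<rho>) < rtrace (N ** \<F> \<rho>) + rtrace \<rho> - rtrace (\<F> \<rho>) + \<epsilon>"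
    using assms(1) is_wlpD[OF assms(2), of N \<rho>]
    by (intro bexI[of _ "f N"]) (auto simp: density_def)
qed

text \<open>Witnesses are chosen backwards, first for \<open>S1\<close> at the intermediate state
  and then for \<open>S0\<close> at the input; the traces of the intermediate state cancel.\<close>

lemma valid_par_Seq:
  assumes S: "valid_par \<Theta> S0 \<Theta>'" "valid_par \<Theta>' S1 \<Psi>" and wf: "wf_prog S0"
  shows "valid_par \<Theta> (Seq S0 S1) \<Psi>"
proof (rule valid_parI)
  fix \<rho> :: "'a qop" and \<G> N and \<epsilon> :: real
  assume \<rho>: "density \<rho>" and \<G>: "\<G> \<in> sem (Seq S0 S1)" and N: "N \<in> \<Psi>" and \<epsilon>: "\<epsilon> > 0"
  from \<epsilon> have \<epsilon>2: "\<epsilon> / 2 > 0" by simp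
  from \<G> obtain \<E> \<F> where \<E>: "\<E> \<in> sem S0" and \<F>: "\<F> \<in> sem S1" and eq: "\<G> = \<F> \<circ> \<E>"
    by auto
  obtain M' where "M' \<in> \<Theta>'"
    and M': "rtrace (M' ** \<E> \<rho>) < rtrace (N ** \<F> (\<E> \<rho>)) + rtrace (\<E> \<rho>) - rtrace (\<F> (\<E> \<rho>)) + \<epsilon> / 2"
    by (rule valid_parE[OF S(2) density_sem[OF wf \<E> \<rho>] \<F> N \<epsilon>2])
  obtain M where "M \<in> \<Theta>"
    "rtrace (M ** \<rho>) < rtrace (M' ** \<E> \<rho>) + rtrace \<rho> - rtrace (\<E> \<rho>) + \<epsilon> / 2"
    by (rule valid_parE[OF S(1) \<rho> \<E> \<open>M' \<in> \<Theta>'\<close> \<epsilon>2])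
  with M' show "\<exists>M\<in>\<Theta>. rtrace (M ** \<rho>) < rtrace (N ** \<G> \<rho>) + rtrace \<rho> - rtrace (\<G> \<rho>) + \<epsilon>"
    by (intro bexI[of _ M]) (auto simp: eq)
qed

text \<open>The two side conditions are used at different states: the one on postconditions at the
  output, which is again a density operator.\<close>

lemma valid_par_Imp:
  assumes le: "\<Theta> \<le>\<^sub>i\<^sub>n\<^sub>f \<Theta>'" "\<Psi>' \<le>\<^sub>i\<^sub>n\<^sub>f \<Psi>" and S: "valid_par \<Theta>' S \<Psi>'" and wf: "wf_prog S"
  shows "valid_par \<Theta> S \<Psi>"
proof (rule valid_parI)
  fix \<rho> :: "'a qop" and \<E> N and \<epsilon> :: real
  assume \<rho>: "density \<rho>" and \<E>: "\<E> \<in> sem S" and N: "N \<in> \<Psi>" and \<epsilon>: "\<epsilon> > 0"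
  from \<epsilon> have \<epsilon>3: "\<epsilon> / 3 > 0" by simp
  obtain N' where "N' \<in> \<Psi>'" and N': "rtrace (N' ** \<E> \<rho>) < rtrace (N ** \<E> \<rho>) + \<epsilon> / 3"
    by (rule le_infE[OF le(2) density_sem[OF wf \<E> \<rho>] N \<epsilon>3])
  obtain M' where "M' \<in> \<Theta>'"
    and M': "rtrace (M' ** \<rho>) < rtrace (N' ** \<E> \<rho>) + rtrace \<rho> - rtrace (\<E> \<rho>) + \<epsilon> / 3"
    by (rule valid_parE[OF S \<rho> \<E> \<open>N' \<in> \<Psi>'\<close> \<epsilon>3])
  obtain M where "M \<in> \<Theta>" "rtrace (M ** \<rho>) < rtrace (M' ** \<rho>) + \<epsilon> / 3"
    by (rule le_infE[OF le(1) \<rho> \<open>M' \<in> \<Theta>'\<close> \<epsilon>3])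
  with M' N' show "\<exists>M\<in>\<Theta>. rtrace (M ** \<rho>) < rtrace (N ** \<E> \<rho>) + rtrace \<rho> - rtrace (\<E> \<rho>) + \<epsilon>"
    by (intro bexI[of _ M]) auto
qed

lemma valid_par_Union:
  assumes "\<And>\<Theta> \<Psi>. (\<Theta>, \<Psi>) \<in> F \<Longrightarrow> valid_par \<Theta> S \<Psi>"
  shows "valid_par (\<Union>(\<Theta>, \<Psi>)\<in>F. \<Theta>) S (\<Union>(\<Theta>, \<Psi>)\<in>F. \<Psi>)"
proof (rule valid_parI)
  fix \<rho> :: "'a qop" and \<E> N and \<epsilon> :: real
  assume *: "density \<rho>" "\<E> \<in> sem S" "N \<in> (\<Union>(\<Theta>, \<Psi>)\<in>F. \<Psi>)" "\<epsilon> > 0"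
  then obtain \<Theta> \<Psi> where F: "(\<Theta>, \<Psi>) \<in> F" "N \<in> \<Psi>" by auto
  obtain M where "M \<in> \<Theta>" "rtrace (M ** \<rho>) < rtrace (N ** \<E> \<rho>) + rtrace \<rho> - rtrace (\<E> \<rho>) + \<epsilon>"
    using valid_parE[OF assms[OF F(1)] *(1,2) F(2) *(4)] .
  with F(1) show "\<exists>M\<in>(\<Union>(\<Theta>, \<Psi>)\<in>F. \<Theta>).
      rtrace (M ** \<rho>) < rtrace (N ** \<E> \<rho>) + rtrace \<rho> - rtrace (\<E> \<rho>) + \<epsilon>"
    by (intro bexI[of _ M]) auto
qed

context projective_measurement
begin

lemma rtrace_meas:
  "rtrace ((proj_op qs P0 M + proj_op qs P1 N) ** \<rho>) =
     rtrace (M ** proj_op qs P0 \<rho>) + rtrace (N ** proj_op qs P1 \<rho>)"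
  by (simp add: matrix_add_rdistrib rtrace_add rtrace_proj_op)

lemma assertion_meas_sum:
  "assertion \<Theta>0 \<Longrightarrow> assertion \<Theta>1 \<Longrightarrow> assertion (meas_sum P0 P1 qs \<Theta>0 \<Theta>1)"
  by (auto simp: assertion_def meas_sum_def predicate_meas)

text \<open>Elements of \<open>\<Theta>0\<close> and \<open>\<Theta>1\<close> are picked
  independently at the two projected states, which matches the free combination in
  \<open>meas_sum\<close>.\<close>

lemma valid_par_Cond:
  assumes S: "valid_par \<Theta>1 S1 \<Psi>" "valid_par \<Theta>0 S0 \<Psi>"
  shows "valid_par (meas_sum P0 P1 qs \<Theta>0 \<Theta>1) (Cond P0 P1 qs S1 S0) \<Psi>"
proof (rule valid_parI)
  fix \<rho> :: "'q qop" and \<G> N and \<epsilon> :: real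
  assume \<rho>: "density \<rho>" and \<G>: "\<G> \<in> sem (Cond P0 P1 qs S1 S0)" and N: "N \<in> \<Psi>" and \<epsilon>: "\<epsilon> > 0"
  from \<epsilon> have \<epsilon>2: "\<epsilon> / 2 > 0" by simp
  define \<rho>0 \<rho>1 where "\<rho>0 = proj_op qs P0 \<rho>" and "\<rho>1 = proj_op qs P1 \<rho>"
  have \<rho>01: "density \<rho>0" "density \<rho>1"
    using \<rho> by (simp_all add: \<rho>0_def \<rho>1_def density_proj_op)
  from \<G> obtain \<E> \<F> where \<E>: "\<E> \<in> sem S0" and \<F>: "\<F> \<in> sem S1"
    and "\<G> = (\<lambda>\<rho>. \<E> (proj_op qs P0 \<rho>) + \<F> (proj_op qs P1 \<rho>))"
    by auto
  then have eq: "\<G> \<rho> = \<E> \<rho>0 + \<F> \<rho>1" by (simp add: \<rho>0_def \<rho>1_def)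
  obtain M0 where M0: "M0 \<in> \<Theta>0"
    "rtrace (M0 ** \<rho>0) < rtrace (N ** \<E> \<rho>0) + rtrace \<rho>0 - rtrace (\<E> \<rho>0) + \<epsilon> / 2"
    by (rule valid_parE[OF S(2) \<rho>01(1) \<E> N \<epsilon>2])
  obtain M1 where M1: "M1 \<in> \<Theta>1"
    "rtrace (M1 ** \<rho>1) < rtrace (N ** \<F> \<rho>1) + rtrace \<rho>1 - rtrace (\<F> \<rho>1) + \<epsilon> / 2"
    by (rule valid_parE[OF S(1) \<rho>01(2) \<F> N \<epsilon>2])
  have "rtrace ((proj_op qs P0 M0 + proj_op qs P1 M1) ** \<rho>)
      < rtrace (N ** \<G> \<rho>) + rtrace \<rho> - rtrace (\<G> \<rho>) + \<epsilon>"
    using M0(2) M1(2) rtrace_proj_op_sum[of \<rho>]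
    by (simp add: eq rtrace_meas matrix_add_ldistrib rtrace_add flip: \<rho>0_def \<rho>1_def)
  with M0(1) M1(1) show "\<exists>M\<in>meas_sum P0 P1 qs \<Theta>0 \<Theta>1.
      rtrace (M ** \<rho>) < rtrace (N ** \<G> \<rho>) + rtrace \<rho> - rtrace (\<G> \<rho>) + \<epsilon>"
    by (auto simp: meas_sum_def)
qed

text \<open>Soundness for finite approximations of the loop. The induction varies scheduler, state
  and margin, as each step passes to the shifted scheduler and the state after one round and spends
  half of the margin.\<close>

lemma valid_par_while_partial:
  assumes S: "valid_par \<Theta> S (meas_sum P0 P1 qs \<Psi> \<Theta>)" and wf: "wf_prog S"
    and "\<Theta> \<noteq> {}" "assertion \<Theta>" "assertion \<Psi>" and N: "N \<in> \<Psi>"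
    and "\<And>k. \<eta> k \<in> sem S" and "density \<rho>" and "\<epsilon> > 0"
  defines "\<sigma> \<equiv> \<lambda>n \<eta> \<rho>. \<Sum>i<n. while_term \<eta> i \<rho>"
  shows "\<exists>M\<in>meas_sum P0 P1 qs \<Psi> \<Theta>.
    rtrace (M ** \<rho>) < rtrace (N ** \<sigma> n \<eta> \<rho>) + rtrace \<rho> - rtrace (\<sigma> n \<eta> \<rho>) + \<epsilon>"
  using assms(7-9)
proof (induction n arbitrary: \<eta> \<rho> \<epsilon>)
  \<comment> \<open>With no terms the bound is \<open>rtrace \<rho> + \<epsilon>\<close>, which
    every predicate meets; the nonempty \<open>\<Theta>\<close> provides an element of the
    invariant.\<close>
  case 0
  from \<open>\<Theta> \<noteq> {}\<close> obtain K where "K \<in> \<Theta>" by blast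
  then have M: "proj_op qs P0 N + proj_op qs P1 K \<in> meas_sum P0 P1 qs \<Psi> \<Theta>"
    using N by (auto simp: meas_sum_def)
  moreover have "predicate (proj_op qs P0 N + proj_op qs P1 K)"
    using N \<open>K \<in> \<Theta>\<close> \<open>assertion \<Theta>\<close> \<open>assertion \<Psi>\<close>
    by (auto simp: assertion_def intro!: predicate_meas)
  from predicate_rtrace_mult(2)[OF this, of \<rho>]
  have "rtrace ((proj_op qs P0 N + proj_op qs P1 K) ** \<rho>) \<le> rtrace \<rho>"
    using \<open>density \<rho>\<close> by (simp add: density_def)
  ultimately show ?case
    using \<open>\<epsilon> > 0\<close> by (intro bexI[OF _ M]) (simp add: \<sigma>_def)
next
  case (Suc n)
  define \<rho>1 where "\<rho>1 = proj_op qs P1 \<rho>"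
  define \<tau> where "\<tau> = \<sigma> n (\<lambda>k. \<eta> (Suc k)) (\<eta> 0 \<rho>1)"
  have \<rho>1: "density \<rho>1"
    using \<open>density \<rho>\<close> by (simp add: \<rho>1_def density_proj_op)
  have \<sigma>: "\<sigma> (Suc n) \<eta> \<rho> = proj_op qs P0 \<rho> + \<tau>"
    by (simp add: \<sigma>_def \<tau>_def \<rho>1_def sum.lessThan_Suc_shift while_term_0 while_term_Suc
        del: sum.lessThan_Suc)
  have \<epsilon>: "\<epsilon> / 2 > 0" using Suc.prems by simp
  \<comment> \<open>\<open>K\<close> lies in the postcondition of the body and bounds the remaining
    rounds; validity of the body then pulls it back to an element of
    \<open>\<Theta>\<close>.\<close>
  obtain K where K: "K \<in> meas_sum P0 P1 qs \<Psi> \<Theta>"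
    "rtrace (K ** \<eta> 0 \<rho>1) < rtrace (N ** \<tau>) + rtrace (\<eta> 0 \<rho>1) - rtrace \<tau> + \<epsilon> / 2"
    using Suc.IH[of "\<lambda>k. \<eta> (Suc k)", OF Suc.prems(1) density_sem[OF wf Suc.prems(1) \<rho>1] \<epsilon>, of 0]
    by (auto simp: \<tau>_def)
  obtain M where M: "M \<in> \<Theta>"
    "rtrace (M ** \<rho>1) < rtrace (K ** \<eta> 0 \<rho>1) + rtrace \<rho>1 - rtrace (\<eta> 0 \<rho>1) + \<epsilon> / 2"
    by (rule valid_parE[OF S \<rho>1 Suc.prems(1) K(1) \<epsilon>])
  have "rtrace ((proj_op qs P0 N + proj_op qs P1 M) ** \<rho>)
      < rtrace (N ** \<sigma> (Suc n) \<eta> \<rho>) + rtrace \<rho> - rtrace (\<sigma> (Suc n) \<eta> \<rho>) + \<epsilon>"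
    using K(2) M(2) rtrace_proj_op_sum[of \<rho>]
    by (simp add: \<sigma> rtrace_meas matrix_add_ldistrib rtrace_add flip: \<rho>1_def)
  moreover have "proj_op qs P0 N + proj_op qs P1 M \<in> meas_sum P0 P1 qs \<Psi> \<Theta>"
    using N M(1) by (auto simp: meas_sum_def)
  ultimately show ?case by blast
qed

text \<open>Some partial sum brings the bound within \<open>\<epsilon> / 2\<close> of its value for
  the loop; the finite approximation uses the other half.\<close>

lemma valid_par_While:
  assumes S: "valid_par \<Theta> S (meas_sum P0 P1 qs \<Psi> \<Theta>)" and wf: "wf_prog S"
    and "\<Theta> \<noteq> {}" "assertion \<Theta>" "assertion \<Psi>"
  shows "valid_par (meas_sum P0 P1 qs \<Psi> \<Theta>) (While P0 P1 qs S) \<Psi>"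
proof (rule valid_parI)
  fix \<rho> :: "'q qop" and \<G> N and \<epsilon> :: real
  assume \<rho>: "density \<rho>" and \<G>: "\<G> \<in> sem (While P0 P1 qs S)" and N: "N \<in> \<Psi>" and \<epsilon>: "\<epsilon> > 0"
  from \<epsilon> have \<epsilon>2: "\<epsilon> / 2 > 0" by simp
  from \<G> obtain \<eta> where \<eta>: "\<And>k. \<eta> k \<in> sem S" and eq: "\<G> = while_op \<eta>"
    unfolding sem_While[OF projective_measurement_axioms] by auto
  define \<sigma> where "\<sigma> = (\<lambda>n. \<Sum>i<n. while_term \<eta> i \<rho>)"
  have "\<sigma> \<longlonglongrightarrow> \<G> \<rho>"
    unfolding \<sigma>_def eq using \<rho> \<eta> wf by (intro while_op_LIMSEQ sem_quantum_op) (auto simp: density_def)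
  then have "(\<lambda>n. rtrace (N ** \<sigma> n) + rtrace \<rho> - rtrace (\<sigma> n))
      \<longlonglongrightarrow> rtrace (N ** \<G> \<rho>) + rtrace \<rho> - rtrace (\<G> \<rho>)"
    by (intro tendsto_intros tendsto_rtrace_mult tendsto_rtrace)
  then have "\<forall>\<^sub>F n in sequentially. rtrace (N ** \<sigma> n) + rtrace \<rho> - rtrace (\<sigma> n)
      < rtrace (N ** \<G> \<rho>) + rtrace \<rho> - rtrace (\<G> \<rho>) + \<epsilon> / 2"
    by (rule order_tendstoD) (use \<epsilon> in simp)
  then obtain n where n: "rtrace (N ** \<sigma> n) + rtrace \<rho> - rtrace (\<sigma> n)
      < rtrace (N ** \<G> \<rho>) + rtrace \<rho> - rtrace (\<G> \<rho>) + \<epsilon> / 2"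
    by (auto simp: eventually_sequentially)
  obtain M where "M \<in> meas_sum P0 P1 qs \<Psi> \<Theta>"
    "rtrace (M ** \<rho>) < rtrace (N ** \<sigma> n) + rtrace \<rho> - rtrace (\<sigma> n) + \<epsilon> / 2"
    using valid_par_while_partial[OF assms N, of \<eta> \<rho> "\<epsilon> / 2" n] \<eta> \<rho> \<epsilon> by (auto simp: \<sigma>_def)
  with n show "\<exists>M\<in>meas_sum P0 P1 qs \<Psi> \<Theta>.
      rtrace (M ** \<rho>) < rtrace (N ** \<G> \<rho>) + rtrace \<rho> - rtrace (\<G> \<rho>) + \<epsilon>"
    by (intro bexI[of _ M]) auto
qed

end

lemma Init_wlp:
  assumes "distinct qs"
  shows "predicate M \<Longrightarrow> predicate (\<Sum>i<2 ^ length qs. ketbra qs i 0 ** M ** ketbra qs 0 i)"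
    and "is_wlp (set0_op qs) M (\<Sum>i<2 ^ length qs. ketbra qs i 0 ** M ** ketbra qs 0 i)"
  using kraus_predicate[OF set0_kraus[OF assms], of M] kraus_is_wlp[OF set0_kraus[OF assms], of M]
  by (simp_all add: set0_op_kraus adj_ketbra)

lemma Unitary_wlp:
  assumes "distinct qs" and "is_unitary (2 ^ length qs) U"
  shows "predicate M \<Longrightarrow> predicate (adj (cyl qs U) ** M ** cyl qs U)"
    and "is_wlp (unitary_op qs U) M (adj (cyl qs U) ** M ** cyl qs U)"
  using kraus_predicate[OF unitary_kraus[OF assms], of M]
    kraus_is_wlp[OF unitary_kraus[OF assms], of M]
  by (simp_all add: unitary_op_kraus)

text \<open>Being an assertion is proved together with validity, because the loop case uses that the
  elements of \<open>\<Theta>\<close> are predicates.\<close>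

lemma derivable_sound:
  "derivable \<Theta> S \<Psi> \<Longrightarrow> wf_prog S \<Longrightarrow> assertion \<Theta> \<and> assertion \<Psi> \<and> valid_par \<Theta> S \<Psi>"
proof (induction rule: derivable.induct)
  case (Skip \<Theta>)
  then show ?case
    using valid_par_image_wlp[of Skip id \<Theta> "\<lambda>M. M"] by (simp add: is_wlp_id)
next
  case Abort
  show ?case
    using valid_par_image_wlp[of Abort "\<lambda>\<rho>. 0" "{0}" "\<lambda>M. Finite_Cartesian_Product.mat 1"]
    by (simp add: is_wlp_zero assertion_def predicate_0 predicate_one)
next
  case (Init \<Theta> qs)
  then show ?case
    by (auto simp: assertion_def Init_wlp intro!: valid_par_image_wlp[of _ "set0_op qs"])
next
  case (Unit \<Theta> qs U)
  then show ?case
    by (auto simp: assertion_def Unitary_wlp intro!: valid_par_image_wlp[of _ "unitary_op qs U"])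
next
  case (Seq \<Theta> S0 \<Theta>' S1 \<Psi>)
  then show ?case by (auto intro: valid_par_Seq)
next
  case (NDet \<Theta> S0 \<Psi> S1)
  then show ?case by (auto simp: valid_par_iff)
next
  case (Meas \<Theta>1 S1 \<Psi> \<Theta>0 S0 P0 P1 qs)
  then interpret projective_measurement qs P0 P1
    by unfold_locales simp_all
  from Meas show ?case by (simp add: assertion_meas_sum valid_par_Cond)
next
  case (While \<Psi> \<Theta> S P0 P1 qs)
  then interpret projective_measurement qs P0 P1
    by unfold_locales simp_all
  from While show ?case by (simp add: assertion_meas_sum valid_par_While)
next
  case (Imp \<Theta> \<Psi> \<Theta>' S \<Psi>')
  then show ?case by (simp add: valid_par_Imp)
next
  case (Union F S)
  then have "assertion (\<Union>(\<Theta>, \<Psi>)\<in>F. \<Theta>) \<and> assertion (\<Union>(\<Theta>, \<Psi>)\<in>F. \<Psi>)"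
    by (fastforce simp: assertion_def)
  moreover have "valid_par (\<Union>(\<Theta>, \<Psi>)\<in>F. \<Theta>) S (\<Union>(\<Theta>, \<Psi>)\<in>F. \<Psi>)"
    using Union by (intro valid_par_Union) simp
  ultimately show ?case by simp
qed

section \<open>Completeness\<close>

definition wlp :: "('q :: finite) prog \<Rightarrow> 'q qop set \<Rightarrow> 'q qop set" where
  "wlp S \<Psi> = {N. predicate N \<and> (\<exists>\<E>\<in>sem S. \<exists>M\<in>\<Psi>. is_wlp \<E> M N)}"

lemma wlpI: "predicate N \<Longrightarrow> \<E> \<in> sem S \<Longrightarrow> M \<in> \<Psi> \<Longrightarrow> is_wlp \<E> M N \<Longrightarrow> N \<in> wlp S \<Psi>"
  by (auto simp: wlp_def)

lemma wlpE:
  assumes "N \<in> wlp S \<Psi>"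
  obtains \<E> M where "predicate N" "\<E> \<in> sem S" "M \<in> \<Psi>" "is_wlp \<E> M N"
  using assms by (auto simp: wlp_def)

lemma assertion_wlp: "assertion (wlp S \<Psi>)"
  by (auto simp: wlp_def assertion_def)

lemma wlp_nonempty:
  assumes "wf_prog S" "assertion \<Psi>" "\<Psi> \<noteq> {}"
  shows "wlp S \<Psi> \<noteq> {}"
proof -
  obtain \<E> M where *: "\<E> \<in> sem S" "M \<in> \<Psi>"
    using sem_nonempty[of S] assms(3) by blast
  with assms(2) have "predicate M" by (auto simp: assertion_def)
  then obtain N where "predicate N" "is_wlp \<E> M N"
    by (rule quantum_op_wlpE[OF sem_quantum_op[OF assms(1) *(1)]])
  with * have "N \<in> wlp S \<Psi>" by (intro wlpI)
  then show ?thesis by blast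
qed

text \<open>Enlarging an assertion lowers its infimum, so most uses of rule (Imp) below come down to
  set inclusions.\<close>

lemma le_inf_superset: "\<Psi> \<subseteq> \<Theta> \<Longrightarrow> \<Theta> \<le>\<^sub>i\<^sub>n\<^sub>f \<Psi>"
  unfolding le_inf_def Exp_def by (auto intro: INF_superset_mono)

lemma le_inf_refl: "\<Theta> \<le>\<^sub>i\<^sub>n\<^sub>f \<Theta>"
  by (simp add: le_inf_superset)

lemma derivable_pre:
  "assertion \<Theta> \<Longrightarrow> assertion \<Psi> \<Longrightarrow> \<Theta> \<le>\<^sub>i\<^sub>n\<^sub>f \<Theta>' \<Longrightarrow> derivable \<Theta>' S \<Psi> \<Longrightarrow> derivable \<Theta> S \<Psi>"
  by (rule derivable.Imp[OF _ _ _ _ le_inf_refl])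

text \<open>The traces of elements of \<open>wlp S \<Psi>\<close> are values from the right-hand
  side of validity.\<close>

lemma valid_par_le_inf_wlp: "valid_par \<Theta> S \<Psi> \<Longrightarrow> \<Theta> \<le>\<^sub>i\<^sub>n\<^sub>f wlp S \<Psi>"
  unfolding le_inf_iff by (auto elim!: wlpE valid_parE simp: is_wlpD density_def)

lemma derivable_singletons:
  assumes "\<And>M. M \<in> \<Psi> \<Longrightarrow> derivable (wlp S {M}) S {M}"
  shows "derivable (wlp S \<Psi>) S \<Psi>"
proof -
  have "derivable (\<Union>M\<in>\<Psi>. wlp S {M}) S (\<Union>M\<in>\<Psi>. {M})"
    using assms by (rule derivable_UN)
  moreover have "(\<Union>M\<in>\<Psi>. wlp S {M}) = wlp S \<Psi>"
    by (auto simp: wlp_def)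
  ultimately show ?thesis by simp
qed

text \<open>In most cases the rule for the statement, applied to the \<open>wlp\<close> assertions
  of its parts, yields a precondition contained in the desired one; \<open>derivable_pre\<close>
  then enlarges it.\<close>

lemma derivable_wlp: "wf_prog S \<Longrightarrow> assertion \<Psi> \<Longrightarrow> derivable (wlp S \<Psi>) S \<Psi>"
proof (induction S arbitrary: \<Psi>)
  case Skip
  have "\<Psi> \<subseteq> wlp Skip \<Psi>"
    using Skip by (auto simp: assertion_def intro!: wlpI is_wlp_id)
  then show ?case
    using Skip by (intro derivable_pre[OF assertion_wlp _ le_inf_superset derivable.Skip])
next
  case Abort
  \<comment> \<open>Working with singletons accounts for an empty \<open>\<Psi>\<close>: the set
    \<open>wlp Abort {}\<close> is empty and has infinite expectation, which is not below that of
    the identity.\<close>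
  have "derivable (wlp Abort {M}) Abort {M}" if "M \<in> \<Psi>" for M
  proof (rule derivable.Imp[OF assertion_wlp _ _ derivable.Abort])
    show "assertion {M}" using that Abort by (simp add: assertion_def)
    show "wlp Abort {M} \<le>\<^sub>i\<^sub>n\<^sub>f {Finite_Cartesian_Product.mat 1}"
      by (intro le_inf_superset) (auto intro!: wlpI is_wlp_zero predicate_one)
    have "predicate M" using that Abort by (simp add: assertion_def)
    then show "{0} \<le>\<^sub>i\<^sub>n\<^sub>f {M}"
      by (auto simp: le_inf_iff density_def intro: predicate_rtrace_mult(1) le_less_trans
          add_nonneg_pos)
  qed
  then show ?case by (rule derivable_singletons)
next
  case (Init qs)
  have "(\<lambda>M. \<Sum>i<2 ^ length qs. ketbra qs i 0 ** M ** ketbra qs 0 i) ` \<Psi> \<subseteq> wlp (Init qs) \<Psi>"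
    using Init by (auto simp: assertion_def intro!: wlpI Init_wlp)
  then show ?case
    using Init by (intro derivable_pre[OF assertion_wlp _ le_inf_superset derivable.Init])
next
  case (Unitary qs U)
  have "(\<lambda>M. adj (cyl qs U) ** M ** cyl qs U) ` \<Psi> \<subseteq> wlp (Unitary qs U) \<Psi>"
    using Unitary by (auto simp: assertion_def intro!: wlpI Unitary_wlp)
  then show ?case
    using Unitary by (intro derivable_pre[OF assertion_wlp _ le_inf_superset derivable.Unit])
next
  case (Seq S0 S1)
  have "wlp S0 (wlp S1 \<Psi>) \<subseteq> wlp (Seq S0 S1) \<Psi>"
  proof
    fix N assume "N \<in> wlp S0 (wlp S1 \<Psi>)"
    then obtain \<E> K where N: "predicate N" "\<E> \<in> sem S0" "is_wlp \<E> K N" and "K \<in> wlp S1 \<Psi>"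
      by (rule wlpE)
    from this(4) obtain \<F> M where M: "\<F> \<in> sem S1" "M \<in> \<Psi>" "is_wlp \<F> M K"
      by (rule wlpE)
    have "quantum_op \<E>"
      using Seq.prems N(2) by (simp add: sem_quantum_op[of S0])
    then have "is_wlp (\<F> \<circ> \<E>) M N"
      by (rule is_wlp_comp[OF _ M(3) N(3)])
    moreover have "\<F> \<circ> \<E> \<in> sem (Seq S0 S1)"
      unfolding sem.simps using N(2) M(1) by blast
    ultimately show "N \<in> wlp (Seq S0 S1) \<Psi>"
      using N(1) M(2) by (intro wlpI)
  qed
  moreover have "derivable (wlp S0 (wlp S1 \<Psi>)) (Seq S0 S1) \<Psi>"
    using Seq by (intro derivable.Seq) (auto simp: assertion_wlp)
  ultimately show ?case
    using Seq.prems by (intro derivable_pre[OF assertion_wlp _ le_inf_superset])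
next
  case (NDet S0 S1)
  \<comment> \<open>Rule \<open>NDet\<close> asks for one precondition for both branches; the larger
    set can replace each branch's own.\<close>
  have sub: "wlp S0 \<Psi> \<subseteq> wlp (NDet S0 S1) \<Psi>" "wlp S1 \<Psi> \<subseteq> wlp (NDet S0 S1) \<Psi>"
    by (auto simp: wlp_def)
  have "derivable (wlp S0 \<Psi>) S0 \<Psi>" "derivable (wlp S1 \<Psi>) S1 \<Psi>"
    using NDet by simp_all
  with sub show ?case
    using NDet.prems by (intro derivable.NDet derivable_pre[OF assertion_wlp _ le_inf_superset])
next
  case (Cond P0 P1 qs S1 S0)
  then interpret projective_measurement qs P0 P1
    by unfold_locales simp_all
  have "derivable (wlp (Cond P0 P1 qs S1 S0) {M}) (Cond P0 P1 qs S1 S0) {M}" if "M \<in> \<Psi>" for M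
  proof (rule derivable_pre[OF assertion_wlp _ le_inf_superset])
    show M: "assertion {M}" using that Cond.prems by (simp add: assertion_def)
    show "derivable (meas_sum P0 P1 qs (wlp S0 {M}) (wlp S1 {M})) (Cond P0 P1 qs S1 S0) {M}"
      using Cond M by (intro derivable.Meas) simp_all
    show "meas_sum P0 P1 qs (wlp S0 {M}) (wlp S1 {M}) \<subseteq> wlp (Cond P0 P1 qs S1 S0) {M}"
    proof
      fix N assume "N \<in> meas_sum P0 P1 qs (wlp S0 {M}) (wlp S1 {M})"
      then obtain N0 N1 where N: "N = proj_op qs P0 N0 + proj_op qs P1 N1"
        "N0 \<in> wlp S0 {M}" "N1 \<in> wlp S1 {M}"
        by (auto simp: meas_sum_def)
      from N(2) obtain \<E> where \<E>: "predicate N0" "\<E> \<in> sem S0" "is_wlp \<E> M N0"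
        by (auto elim: wlpE)
      from N(3) obtain \<F> where \<F>: "predicate N1" "\<F> \<in> sem S1" "is_wlp \<F> M N1"
        by (auto elim: wlpE)
      from \<E> \<F> show "N \<in> wlp (Cond P0 P1 qs S1 S0) {M}"
        unfolding N(1) by (intro wlpI[OF predicate_meas _ _ is_wlp_cond]) auto
    qed
  qed
  then show ?case by (rule derivable_singletons)
next
  case (While P0 P1 qs S)
  then interpret projective_measurement qs P0 P1
    by unfold_locales simp_all
  have wf: "wf_prog S" using While.prems by simp
  have "derivable (wlp (While P0 P1 qs S) {M}) (While P0 P1 qs S) {M}" if "M \<in> \<Psi>" for M
  proof -
    let ?W = "wlp (While P0 P1 qs S) {M}"
    let ?\<Theta> = "wlp S ?W"
    have M: "assertion {M}" using that While.prems by (simp add: assertion_def)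
    have sub: "meas_sum P0 P1 qs {M} ?\<Theta> \<subseteq> ?W"
    proof
      fix N assume "N \<in> meas_sum P0 P1 qs {M} ?\<Theta>"
      then obtain K where N: "N = proj_op qs P0 M + proj_op qs P1 K" and "K \<in> ?\<Theta>"
        by (auto simp: meas_sum_def)
      from this(2) obtain \<E> L where \<E>: "predicate K" "\<E> \<in> sem S" "is_wlp \<E> L K" and "L \<in> ?W"
        by (rule wlpE)
      from this(4) obtain \<eta> where \<eta>: "\<forall>k. \<eta> k \<in> sem S" "is_wlp (while_op \<eta>) M L"
        by (auto elim!: wlpE simp: sem_While[OF projective_measurement_axioms] simp del: sem.simps)
      \<comment> \<open>Runs \<open>\<E>\<close> in the first round and follows
        \<open>\<eta>\<close> afterwards.\<close>
      define \<eta>' where "\<eta>' = case_nat \<E> \<eta>"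
      have \<eta>': "\<eta>' k \<in> sem S" for k
        using \<E>(2) \<eta>(1) by (simp add: \<eta>'_def split: nat.split)
      have "is_wlp (\<lambda>\<rho>. id (proj_op qs P0 \<rho>) + (while_op \<eta> \<circ> \<E>) (proj_op qs P1 \<rho>)) M N"
        unfolding N using \<E> \<eta> wf by (intro is_wlp_cond is_wlp_id is_wlp_comp[OF sem_quantum_op])
      then have "is_wlp (while_op \<eta>') M N"
        using while_op_unfold[of \<eta>', OF sem_quantum_op[OF wf \<eta>']]
        by (simp add: is_wlp_def \<eta>'_def)
      moreover have "while_op \<eta>' \<in> sem (While P0 P1 qs S)"
        using \<eta>' unfolding sem_While[OF projective_measurement_axioms] by auto
      moreover have "predicate N"
        unfolding N using M \<E>(1) by (intro predicate_meas) (simp_all add: assertion_def)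
      ultimately show "N \<in> ?W" by (intro wlpI) simp_all
    qed
    have "?W \<noteq> {}" by (rule wlp_nonempty[OF While.prems(1) M]) simp
    then have "?\<Theta> \<noteq> {}" by (rule wlp_nonempty[OF wf assertion_wlp])
    have "derivable ?\<Theta> S ?W"
      by (rule While.IH[OF wf assertion_wlp])
    \<comment> \<open>The inclusion \<open>sub\<close> serves twice: here it shrinks the
      postcondition of the body from \<open>?W\<close> to the loop invariant, and at the end it
      enlarges the precondition of the loop to \<open>?W\<close>.\<close>
    from derivable.Imp[OF assertion_wlp assertion_meas_sum[OF M assertion_wlp] le_inf_refl this
        le_inf_superset[OF sub]]
    have "derivable ?\<Theta> S (meas_sum P0 P1 qs {M} ?\<Theta>)" .
    then have "derivable (meas_sum P0 P1 qs {M} ?\<Theta>) (While P0 P1 qs S) {M}"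
      by (rule derivable.While[OF M \<open>?\<Theta> \<noteq> {}\<close>])
    then show ?thesis
      by (rule derivable_pre[OF assertion_wlp M le_inf_superset[OF sub]])
  qed
  then show ?case by (rule derivable_singletons)
qed

theorem theorem4p6:
  fixes S :: "('q :: finite) prog" and \<Theta> \<Psi> :: "'q qop set"
  assumes "wf_prog S" and "assertion \<Theta>" and "assertion \<Psi>"
  shows "derivable \<Theta> S \<Psi> \<longleftrightarrow> valid_par \<Theta> S \<Psi>"
proof
  assume "derivable \<Theta> S \<Psi>"
  then show "valid_par \<Theta> S \<Psi>" using derivable_sound assms(1) by blast
next
  assume "valid_par \<Theta> S \<Psi>"
  then show "derivable \<Theta> S \<Psi>"
    by (intro derivable_pre[OF assms(2,3) valid_par_le_inf_wlp derivable_wlp] assms(1,3))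
qed

end
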